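(* Every periodic cutting sequence on the double pentagon has several palindromic properties. It reads the same in the reverse order if: (1) the base and exponent are reversed (that is, each symbol $x^y$ of the decorated sequence is replaced by $y^x$); or if (2) bases and exponents are treated the same; or if (3) we ignore the exponents and remove the first digit (here using the order given by applying the substitutions $r_0,r_1,r_2,r_3$ to $1^2\,2^1$ or $3^4\,4^3$).
   Context: The double pentagon is the translation surface obtained from a regular pentagon $Q$ with a horizontal bottom side, and its half-turn image $-Q$, by gluing each side of $Q$ by translation to the parallel side of $-Q$. The five glued edges are labeled: label 1 is the edge with direction at angle $\pi/5$, label 2 the edge with direction $4\pi/5$, label 3 the edge with direction $3\pi/5$, label 4 the edge with direction $2\pi/5$, label 5 the horizontal edge. The cutting sequence of a trajectory is the sequence of labels of the edges it crosses; for a periodic trajectory it is periodic, and it is recorded by a period $e_1e_2\cdots e_k$, which is determined up to cyclic shift. Trajectories are taken with direction $\theta\in[0,\pi/5)$ (by the symmetry of the surface there is no loss in doing so); for these, consecutive labels always differ by $1$. The decorated form of a periodic cutting sequence $e_1e_2\cdots e_k$ is $e_1^{e_2}e_2^{e_3}\cdots e_k^{e_1}$: each symbol $x^y$ has base $x$ and exponent $y$, the exponent being the next label. In each periodic direction there are two cylinders (maximal families of parallel periodic trajectories), a short and a long one with length ratio $(1+\sqrt5)/2$; trajectories in them are called short and long. The substitutions $r_i$ on decorated words (applied symbol by symbol) are: $r_0$: $1^2\to2^1$; $2^1\to1^2$; $2^3\to1^22^33^4$; $3^2\to4^33^22^1$; $3^4\to4^3$; $4^3\to3^4$; $4^5\to3^44^5$;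 $5^4\to5^44^3$. $r_1$: $1^2\to3^44^5$; $2^1\to5^44^3$; $2^3\to5^44^33^22^1$; $3^2\to1^22^33^44^5$; $3^4\to1^22^33^4$; $4^3\to4^33^22^1$; $4^5\to4^33^2$; $5^4\to2^33^4$. $r_2$: $1^2\to4^33^2$; $2^1\to2^33^4$; $2^3\to2^33^44^5$; $3^2\to5^44^33^2$; $3^4\to5^44^33^22^1$; $4^3\to1^22^33^44^5$; $4^5\to1^22^3$; $5^4\to3^22^1$. $r_3$: $1^2\to1^22^3$; $2^1\to3^22^1$; $2^3\to3^2$; $3^2\to2^3$; $3^4\to2^33^44^5$; $4^3\to5^44^33^2$; $4^5\to5^4$; $5^4\to4^5$. Up to cyclic shift, the periods of the decorated cutting sequences of periodic trajectories with direction in $[0,\pi/5)$ are the words obtained from $1^22^1$ (short) or $3^44^3$ (long) by finite compositions of the $r_i$; "the order given by applying the substitutions" in (3) means that the period is written starting where the word so obtained starts. *)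

theory Defs
  imports "HOL-Analysis.Analysis"
begin

datatype label = L1 | L2 | L3 | L4 | L5

primrec edge_angle :: "label \<Rightarrow> real" where
  "edge_angle L1 = pi / 5"
| "edge_angle L2 = 4 * pi / 5"
| "edge_angle L3 = 3 * pi / 5"
| "edge_angle L4 = 2 * pi / 5"
| "edge_angle L5 = 0"

(* Counterclockwise, centred at 0; the vertices 0 and 1 span the horizontal bottom side. *)
definition pentagon_vertex :: "nat \<Rightarrow> complex" where
  "pentagon_vertex k = cis (2 * pi * real k / 5 - 7 * pi / 10)"

definition pentagon :: "complex set" where
  "pentagon = convex hull (pentagon_vertex ` {..<5})"

(* The union has exactly one member: the side, without its endpoints, of direction edge_angle l. *)
definition pentagon_side :: "label \<Rightarrow> complex set" where
  "pentagon_side l =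
     \<Union> {open_segment (pentagon_vertex k) (pentagon_vertex (Suc k)) | k.
          k < 5 \<and> (\<exists>t. pentagon_vertex (Suc k) - pentagon_vertex k
                         = complex_of_real t * cis (edge_angle l))}"

(* The surface consists of two polygons in separate planes: True stands for Q, False for -Q. *)
definition polygon :: "bool \<Rightarrow> complex set" where
  "polygon b = (if b then pentagon else uminus ` pentagon)"

definition polygon_side :: "bool \<Rightarrow> label \<Rightarrow> complex set" where
  "polygon_side b l = (if b then pentagon_side l else uminus ` pentagon_side l)"

(* The point z of the side l of polygon b is identified with the point z' of the parallel side
   of the other polygon. *)
definition glued :: "bool \<Rightarrow> label \<Rightarrow> complex \<Rightarrow> complex \<Rightarrow> bool" where
  "glued b l z z' \<longleftrightarrow>
     (\<exists>c. (+) c ` polygon_side b l = polygon_side (\<not> b) l \<and>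
          z \<in> polygon_side b l \<and> z' = c + z)"

record passage =
  in_Q :: bool
  entry_point :: complex
  exit_point :: complex
  exit_label :: label

(* A bi-infinite trajectory in direction \<theta> that avoids the vertices, given by its
   successive passages through the polygons. *)
definition trajectory :: "real \<Rightarrow> (int \<Rightarrow> passage) \<Rightarrow> bool" where
  "trajectory \<theta> T \<longleftrightarrow>
     (\<forall>n. (\<exists>t>0. exit_point (T n) = entry_point (T n) + complex_of_real t * cis \<theta>) \<and>
          open_segment (entry_point (T n)) (exit_point (T n)) \<subseteq> interior (polygon (in_Q (T n))) \<and>
          in_Q (T (n + 1)) = (\<not> in_Q (T n)) \<and>
          glued (in_Q (T n)) (exit_label (T n)) (exit_point (T n)) (entry_point (T (n + 1))))"

definition has_period :: "(int \<Rightarrow> 'a) \<Rightarrow> nat \<Rightarrow> bool" where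
  "has_period f k \<longleftrightarrow> 0 < k \<and> (\<forall>n. f (n + int k) = f n)"

definition periodic_trajectory :: "real \<Rightarrow> (int \<Rightarrow> passage) \<Rightarrow> bool" where
  "periodic_trajectory \<theta> T \<longleftrightarrow> trajectory \<theta> T \<and> (\<exists>k. has_period T k)"

definition cutting_sequence :: "(int \<Rightarrow> passage) \<Rightarrow> int \<Rightarrow> label" where
  "cutting_sequence T n = exit_label (T n)"

(* A shortest period, read from any position; it is unique up to cyclic shift. *)
definition period_word :: "(int \<Rightarrow> 'a) \<Rightarrow> 'a list \<Rightarrow> bool" where
  "period_word e w \<longleftrightarrow>
     has_period e (length w) \<and> (\<forall>k. has_period e k \<longrightarrow> length w \<le> k) \<and>
     (\<exists>m. w = map (\<lambda>i. e (m + int i)) [0..<length w])"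

definition cyclic_shift :: "'a list \<Rightarrow> 'a list \<Rightarrow> bool" where
  "cyclic_shift u v \<longleftrightarrow> (\<exists>m. v = rotate m u)"

(* The pair (x, y) stands for the symbol with base x and exponent y. *)
type_synonym symbol = "label \<times> label"

definition decorate :: "label list \<Rightarrow> symbol list" where
  "decorate w = zip w (rotate1 w)"

(* Base and exponent of every symbol, written with equal rank: x1 y1 x2 y2 ... *)
definition digits :: "symbol list \<Rightarrow> label list" where
  "digits u = concat (map (\<lambda>(x, y). [x, y]) u)"

(* Pairs of labels that do not differ by 1 do not occur and are sent to []. *)
fun r0 :: "symbol \<Rightarrow> symbol list" where
  "r0 (L1, L2) = [(L2, L1)]"
| "r0 (L2, L1) = [(L1, L2)]"
| "r0 (L2, L3) = [(L1, L2), (L2, L3), (L3, L4)]"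
| "r0 (L3, L2) = [(L4, L3), (L3, L2), (L2, L1)]"
| "r0 (L3, L4) = [(L4, L3)]"
| "r0 (L4, L3) = [(L3, L4)]"
| "r0 (L4, L5) = [(L3, L4), (L4, L5)]"
| "r0 (L5, L4) = [(L5, L4), (L4, L3)]"
| "r0 _ = []"

fun r1 :: "symbol \<Rightarrow> symbol list" where
  "r1 (L1, L2) = [(L3, L4), (L4, L5)]"
| "r1 (L2, L1) = [(L5, L4), (L4, L3)]"
| "r1 (L2, L3) = [(L5, L4), (L4, L3), (L3, L2), (L2, L1)]"
| "r1 (L3, L2) = [(L1, L2), (L2, L3), (L3, L4), (L4, L5)]"
| "r1 (L3, L4) = [(L1, L2), (L2, L3), (L3, L4)]"
| "r1 (L4, L3) = [(L4, L3), (L3, L2), (L2, L1)]"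
| "r1 (L4, L5) = [(L4, L3), (L3, L2)]"
| "r1 (L5, L4) = [(L2, L3), (L3, L4)]"
| "r1 _ = []"

fun r2 :: "symbol \<Rightarrow> symbol list" where
  "r2 (L1, L2) = [(L4, L3), (L3, L2)]"
| "r2 (L2, L1) = [(L2, L3), (L3, L4)]"
| "r2 (L2, L3) = [(L2, L3), (L3, L4), (L4, L5)]"
| "r2 (L3, L2) = [(L5, L4), (L4, L3), (L3, L2)]"
| "r2 (L3, L4) = [(L5, L4), (L4, L3), (L3, L2), (L2, L1)]"
| "r2 (L4, L3) = [(L1, L2), (L2, L3), (L3, L4), (L4, L5)]"
| "r2 (L4, L5) = [(L1, L2), (L2, L3)]"
| "r2 (L5, L4) = [(L3, L2), (L2, L1)]"
| "r2 _ = []"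

fun r3 :: "symbol \<Rightarrow> symbol list" where
  "r3 (L1, L2) = [(L1, L2), (L2, L3)]"
| "r3 (L2, L1) = [(L3, L2), (L2, L1)]"
| "r3 (L2, L3) = [(L3, L2)]"
| "r3 (L3, L2) = [(L2, L3)]"
| "r3 (L3, L4) = [(L2, L3), (L3, L4), (L4, L5)]"
| "r3 (L4, L3) = [(L5, L4), (L4, L3), (L3, L2)]"
| "r3 (L4, L5) = [(L5, L4)]"
| "r3 (L5, L4) = [(L4, L5)]"
| "r3 _ = []"

inductive_set substitution_words :: "symbol list set" where
  short_seed: "[(L1, L2), (L2, L1)] \<in> substitution_words"
| long_seed: "[(L3, L4), (L4, L3)] \<in> substitution_words"
| substitute: "u \<in> substitution_words \<Longrightarrow> r \<in> {r0, r1, r2, r3} \<Longrightarrow>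
    concat (map r u) \<in> substitution_words"

end

theory Submission
  imports Defs
begin

text \<open>
  Measured across the flow, the sides have widths $u$, $u+V$, $U+V$, $U+v$, $v$ with
  $u$ and $v$ proportional to $\sin(\pi/5-\theta)$ and $\sin\theta$, and $U=\phi u$,
  $V=\phi v$ for the golden ratio $\phi$. A trajectory thus becomes an orbit of a piecewise
  translation acting on the sides. Writing $(u,v)$ as the image of $(u',v')$ under one of four
  matrices with entries in $\mathbb{Z}[\phi]$, with $u'>0$ and $v'\ge0$, the first return map to suitable
  subintervals of the sides is the piecewise translation for $(u',v')$, and one of its steps unfolds
  by the substitution $r_i$. This replaces a closed orbit by a shorter one unless $v=0$, where the
  periods are $1^22^1$ and $3^44^3$. Reversal with exchange of base and exponent commutes with each
  $r_i$ and fixes both seeds, hence fixes every substitution word; the three palindromic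
  properties follow from this symmetry.
\<close>

section \<open>Cyclic words\<close>

text \<open>The descent is by the length of the word and not by (u, v): the successive pairs need
  not reach v = 0 in every direction. Under r1 and r2 every symbol becomes longer. Under r0 and r3
  some symbols have one-letter images, and a monotone quantity shows that no closed orbit reads such
  symbols alone. For r0 this fails when v = 0, which is therefore the base case. There the closed
  orbits also read proper powers of the seeds; a shortest period is primitive, and primitivity is
  inherited under desubstitution, so these powers are excluded. A second obstacle is that a period
  of the labels is not at once a period of the crossing points: the orbit could drift. A constant
  drift contradicts the periodicity of the trajectory. In the piecewise translation u, v, U, V are
  independent parameters. The computation of the first returns is then a matter of linear
  inequalities, and phi^2 = phi + 1 enters only when a sector is chosen.\<close>

lemma cyclic_shift_trans: "cyclic_shift u v \<Longrightarrow> cyclic_shift v w \<Longrightarrow> cyclic_shift u w"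
  unfolding cyclic_shift_def by (auto simp: rotate_rotate)

lemma rotate_length_minus: "n \<le> length u \<Longrightarrow> rotate (length u - n) (rotate n u) = u"
  by (simp add: rotate_rotate)

lemma cyclic_shift_sym: "cyclic_shift u v \<Longrightarrow> cyclic_shift v u"
proof -
  assume "cyclic_shift u v"
  then obtain m where m: "v = rotate m u" unfolding cyclic_shift_def by blast
  have "rotate (length u - m mod length u) (rotate (m mod length u) u) = u"
    by (cases "u = []") (auto intro!: rotate_length_minus simp: less_imp_le)
  then show ?thesis
    unfolding cyclic_shift_def m by (metis rotate_conv_mod)
qed

lemma cyclic_shift_append: "cyclic_shift (u @ v) (v @ u)"
  unfolding cyclic_shift_def by (metis rotate_append)

lemma rotate_eq_append: "\<exists>a b. u = a @ b \<and> rotate n u = b @ a"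
  by (metis append_take_drop_id rotate_drop_take)

lemma cyclic_shift_iff_append: "cyclic_shift u v \<longleftrightarrow> (\<exists>a b. u = a @ b \<and> v = b @ a)"
proof
  assume "cyclic_shift u v"
  then obtain n where "v = rotate n u" unfolding cyclic_shift_def by blast
  then show "\<exists>a b. u = a @ b \<and> v = b @ a" using rotate_eq_append[of u n] by blast
qed (use cyclic_shift_append in blast)

lemma cyclic_shift_concat_map:
  assumes "cyclic_shift u v" shows "cyclic_shift (concat (map f u)) (concat (map f v))"
proof -
  obtain a b where "u = a @ b" "v = b @ a" using assms cyclic_shift_iff_append by blast
  then show ?thesis by (simp add: cyclic_shift_append)
qed

lemma cyclic_shift_map:
  assumes "cyclic_shift u v" shows "cyclic_shift (map f u) (map f v)"
proof -
  obtain a b where "u = a @ b" "v = b @ a" using assms cyclic_shift_iff_append by blast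
  then show ?thesis by (simp add: cyclic_shift_append)
qed

lemma cyclic_shift_rev:
  assumes "cyclic_shift u v" shows "cyclic_shift (rev u) (rev v)"
proof -
  obtain a b where "u = a @ b" "v = b @ a" using assms cyclic_shift_iff_append by blast
  then show ?thesis by (simp add: cyclic_shift_append)
qed

text \<open>Phrased by rotations, since words matter only up to cyclic shift; it rules out proper
  powers.\<close>

definition primitive :: "'a list \<Rightarrow> bool" where
  "primitive u \<longleftrightarrow> (\<forall>k. 0 < k \<and> k < length u \<longrightarrow> rotate k u \<noteq> u)"

lemma primitive_rotate:
  assumes "primitive u" shows "primitive (rotate n u)"
  unfolding primitive_def
proof (intro allI impI notI)
  fix k assume k: "0 < k \<and> k < length (rotate n u)" and eq: "rotate k (rotate n u) = rotate n u"
  obtain m where m: "u = rotate m (rotate n u)"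
    using cyclic_shift_sym unfolding cyclic_shift_def by blast
  have "rotate k u = rotate m (rotate k (rotate n u))"
    by (subst m) (simp add: rotate_rotate add.left_commute)
  also have "\<dots> = u" using eq m by simp
  finally show False using assms k unfolding primitive_def by simp
qed

text \<open>A proper rotation fixing \<open>u\<close> splits it as \<open>a @ b = b @ a\<close>. The
  images of the two parts commute as well, and both are nonempty because \<open>f\<close> erases no
  symbol of \<open>u\<close>.\<close>

lemma primitive_of_concat_map:
  assumes "primitive (concat (map f u))" and "\<And>x. x \<in> set u \<Longrightarrow> f x \<noteq> []"
  shows "primitive u"
  unfolding primitive_def
proof (intro allI impI notI)
  fix k assume k: "0 < k \<and> k < length u" and eq: "rotate k u = u"
  define a b where "a = take k u" and "b = drop k u"
  have u: "u = a @ b" "u = b @ a" "a \<noteq> []" "b \<noteq> []"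
    using k eq by (auto simp: a_def b_def rotate_drop_take)
  let ?g = "\<lambda>x. concat (map f x)"
  have "?g a \<noteq> []" "?g b \<noteq> []" using u assms(2) by (auto simp: neq_Nil_conv)
  moreover have "?g u = ?g a @ ?g b" using u(1) by simp
  moreover have "?g u = ?g b @ ?g a" using u(2) by (metis concat_append map_append)
  ultimately have "rotate (length (?g a)) (?g u) = ?g u" "length (?g a) < length (?g u)"
    "0 < length (?g a)"
    by (simp_all add: rotate_append)
  then show False using assms(1) unfolding primitive_def by blast
qed

lemma length_concat_map_less:
  assumes "\<And>x. x \<in> set u \<Longrightarrow> f x \<noteq> []" and "\<exists>x\<in>set u. 2 \<le> length (f x)"
  shows "length u < length (concat (map f u))"
proof -
  have "length u = (\<Sum>x\<leftarrow>u. 1)" by (simp add: sum_list_triv)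
  also have "\<dots> < (\<Sum>x\<leftarrow>u. length (f x))"
    using assms
  proof (induction u)
    case (Cons a u)
    have le: "(\<Sum>x\<leftarrow>u. 1) \<le> (\<Sum>x\<leftarrow>u. length (f x))"
      using Cons.prems(1) by (intro sum_list_mono) (simp add: Suc_leI)
    show ?case
    proof (cases "2 \<le> length (f a)")
      case True
      then show ?thesis using le by simp
    next
      case False
      then have "(\<Sum>x\<leftarrow>u. 1) < (\<Sum>x\<leftarrow>u. length (f x))" using Cons by auto
      moreover have "1 \<le> length (f a)" using Cons.prems(1) by (simp add: Suc_leI)
      ultimately show ?thesis unfolding list.map sum_list.Cons by linarith
    qed
  qed simp
  finally show ?thesis by (simp add: length_concat comp_def)
qed


section \<open>Reversal of substitution words\<close>

lemma length_decorate [simp]: "length (decorate w) = length w"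
  by (simp add: decorate_def)

lemma map_fst_decorate [simp]: "map fst (decorate w) = w"
  by (simp add: decorate_def)

lemma map_snd_decorate [simp]: "map snd (decorate w) = rotate1 w"
  by (simp add: decorate_def)

lemma rotate1_zip: "length x = length y \<Longrightarrow> rotate1 (zip x y) = zip (rotate1 x) (rotate1 y)"
  by (cases x; cases y) auto

lemma decorate_rotate: "decorate (rotate n w) = rotate n (decorate w)"
proof (induction n)
  case (Suc n)
  have "decorate (rotate1 x) = rotate1 (decorate x)" for x :: "label list"
    by (simp add: decorate_def rotate1_zip)
  then show ?case using Suc by simp
qed simp

lemma substitution_word_reversal:
  assumes "u \<in> substitution_words"
  shows "rev (map prod.swap u) = u"
  using assms
proof induction
  case (substitute u r)
  have rp: "map prod.swap (rev (r p)) = r (prod.swap p)" for p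
  proof -
    obtain x y where "p = (x, y)" by fastforce
    then show ?thesis using substitute.hyps(2) by (cases x; cases y) auto
  qed
  have "rev (map prod.swap (concat (map r u))) = concat (map r (rev (map prod.swap u)))"
    by (simp add: rev_concat map_concat rev_map comp_def rp)
  then show ?case using substitute.IH by simp
qed auto

text \<open>The bases of the reversed and swapped word are the reversed exponents, and the exponents
  form \<open>rotate1 w\<close>. Hence \<open>rev (rotate1 w) = w\<close>, which for
  \<open>w = x # w'\<close> reads \<open>x # rev w' = x # w'\<close>.\<close>

lemma palindrome_of_reversal:
  assumes "rev (map prod.swap (decorate w)) = decorate w"
  shows "rev (tl w) = tl w"
proof (cases w)
  case (Cons x w')
  have "rev (map fst (map prod.swap (decorate w))) = map fst (decorate w)"
    using assms by (metis rev_map)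
  then have "rev (rotate1 w) = w" by (simp add: comp_def)
  then show ?thesis using Cons by simp
qed simp

text \<open>Reversing the digits also exchanges the two digits within each symbol; property (2)
  thereby reduces to property (1).\<close>

lemma digits_rev: "rev (digits u) = digits (rev (map prod.swap u))"
  by (simp add: digits_def rev_concat rev_map comp_def case_prod_beta)

lemma palindromic_properties:
  assumes u: "u \<in> substitution_words" and shift: "cyclic_shift (decorate w) u"
  shows "cyclic_shift (decorate w) (rev (map prod.swap (decorate w)))"
    and "cyclic_shift (digits (decorate w)) (rev (digits (decorate w)))"
    and "rev (tl (map fst u)) = tl (map fst u)"
proof -
  have sym: "rev (map prod.swap u) = u" using u by (rule substitution_word_reversal)
  have "cyclic_shift (rev (map prod.swap u)) (rev (map prod.swap (decorate w)))"
    using cyclic_shift_rev[OF cyclic_shift_map[OF cyclic_shift_sym[OF shift]]] .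
  then show *: "cyclic_shift (decorate w) (rev (map prod.swap (decorate w)))"
    using shift cyclic_shift_trans sym by metis
  show "cyclic_shift (digits (decorate w)) (rev (digits (decorate w)))"
    unfolding digits_rev using * by (subst (1 2) digits_def) (rule cyclic_shift_concat_map)
  \<comment> \<open>Property (3) depends on the starting point, so it is read off \<open>u\<close>
    itself, which is a decorated word because \<open>decorate\<close> commutes with
    rotation.\<close>
  obtain m where "u = decorate (rotate m w)"
    using shift decorate_rotate unfolding cyclic_shift_def by metis
  then show "rev (tl (map fst u)) = tl (map fst u)"
    using palindrome_of_reversal sym by (metis map_fst_decorate)
qed

section \<open>The piecewise translation on the sides\<close>

text \<open>
  The real number is the distance of the crossing point from the upper end of the side, measured
  across the flow.
\<close>

type_synonym crossing = "label \<times> real"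

fun width :: "real \<Rightarrow> real \<Rightarrow> real \<Rightarrow> real \<Rightarrow> label \<Rightarrow> real" where
  "width u v U V L1 = u"
| "width u v U V L2 = u + V"
| "width u v U V L3 = U + V"
| "width u v U V L4 = U + v"
| "width u v U V L5 = v"

definition on_sides :: "real \<Rightarrow> real \<Rightarrow> real \<Rightarrow> real \<Rightarrow> crossing set" where
  "on_sides u v U V = {(l, y). 0 < y \<and> y < width u v U V l}"

lemma mem_on_sides [simp]: "(l, y) \<in> on_sides u v U V \<longleftrightarrow> 0 < y \<and> y < width u v U V l"
  by (simp add: on_sides_def)

text \<open>A crossing that runs into a vertex has no successor: hence a relation and strict
  inequalities. The passages between 1 and 2, 2 and 3, 3 and 4, 4 and 5 fill strips of widths
  \<open>u\<close>, \<open>V\<close>, \<open>U\<close>, \<open>v\<close>.\<close>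

inductive step :: "real \<Rightarrow> real \<Rightarrow> real \<Rightarrow> real \<Rightarrow> crossing \<Rightarrow> crossing \<Rightarrow> bool"
  for u v U V where
  "0 < y \<Longrightarrow> y < u \<Longrightarrow> step u v U V (L1, y) (L2, y)"
| "V < y \<Longrightarrow> y < u + V \<Longrightarrow> step u v U V (L2, y) (L1, y - V)"
| "0 < y \<Longrightarrow> y < V \<Longrightarrow> step u v U V (L2, y) (L3, y + U)"
| "0 < y \<Longrightarrow> y < V \<Longrightarrow> step u v U V (L3, y) (L2, y + u)"
| "V < y \<Longrightarrow> y < U + V \<Longrightarrow> step u v U V (L3, y) (L4, y - V)"
| "v < y \<Longrightarrow> y < U + v \<Longrightarrow> step u v U V (L4, y) (L3, y - v)"
| "0 < y \<Longrightarrow> y < v \<Longrightarrow> step u v U V (L4, y) (L5, y)"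
| "0 < y \<Longrightarrow> y < v \<Longrightarrow> step u v U V (L5, y) (L4, y + U)"

inductive_simps step_simps [simp]:
  "step u v U V (L1, y) s"
  "step u v U V (L2, y) s"
  "step u v U V (L3, y) s"
  "step u v U V (L4, y) s"
  "step u v U V (L5, y) s"

lemma right_unique_step: "right_unique (step u v U V)"
  by (rule right_uniqueI, rename_tac s s1 s2, case_tac s, case_tac "fst s") auto

section \<open>Words read along orbits and first returns to a section\<close>

fun run :: "(crossing \<Rightarrow> crossing \<Rightarrow> bool) \<Rightarrow> crossing \<Rightarrow> symbol list \<Rightarrow> crossing \<Rightarrow> bool" where
  "run S s [] s' \<longleftrightarrow> s = s'"
| "run S s (p # ps) s' \<longleftrightarrow> (\<exists>s1. S s s1 \<and> p = (fst s, fst s1) \<and> run S s1 ps s')"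

lemma run_append: "run S s (ps @ qs) s' \<longleftrightarrow> (\<exists>s1. run S s ps s1 \<and> run S s1 qs s')"
  by (induction ps arbitrary: s) auto

text \<open>The word of a single return. Only the intermediate points are kept out of
  \<open>M\<close>; the empty word is excluded so that removing an excursion shortens a run.\<close>

fun excursion :: "(crossing \<Rightarrow> crossing \<Rightarrow> bool) \<Rightarrow> crossing set \<Rightarrow> crossing \<Rightarrow> symbol list \<Rightarrow> crossing \<Rightarrow> bool" where
  "excursion S M s [] s' \<longleftrightarrow> False"
| "excursion S M s [p] s' \<longleftrightarrow> S s s' \<and> p = (fst s, fst s')"
| "excursion S M s (p # q # ps) s' \<longleftrightarrow>
     (\<exists>s1. S s s1 \<and> p = (fst s, fst s1) \<and> s1 \<notin> M \<and> excursion S M s1 (q # ps) s')"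

text \<open>Describes points of the section whose orbit meets a vertex before it can return; they do
  not lie on closed runs that visit the section.\<close>

primrec dies :: "nat \<Rightarrow> (crossing \<Rightarrow> crossing \<Rightarrow> bool) \<Rightarrow> crossing set \<Rightarrow> crossing \<Rightarrow> bool" where
  "dies 0 S M s \<longleftrightarrow> (\<forall>s1. \<not> S s s1)"
| "dies (Suc n) S M s \<longleftrightarrow> (\<forall>s1. S s s1 \<longrightarrow> s1 \<notin> M \<and> dies n S M s1)"

text \<open>Holds vacuously once the orbit has ended at a vertex. A closed run always continues, so
  there it yields a genuine visit to \<open>M\<close>.\<close>

primrec hits :: "nat \<Rightarrow> (crossing \<Rightarrow> crossing \<Rightarrow> bool) \<Rightarrow> crossing set \<Rightarrow> crossing \<Rightarrow> bool" where
  "hits 0 S M s \<longleftrightarrow> s \<in> M"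
| "hits (Suc n) S M s \<longleftrightarrow> s \<in> M \<or> (\<forall>s1. S s s1 \<longrightarrow> hits n S M s1)"

text \<open>By determinism the run follows the excursion. It cannot stop earlier, since it ends in
  \<open>M\<close> and the excursion stays outside \<open>M\<close> until its last point.\<close>

lemma excursion_prefix:
  assumes det: "right_unique S"
    and exc: "excursion S M s qs s1" and run: "run S s ps s'" "ps \<noteq> []" "s' \<in> M"
  shows "\<exists>ps'. ps = qs @ ps' \<and> run S s1 ps' s'"
  using exc run
proof (induction qs arbitrary: s ps)
  case (Cons q qs)
  obtain p ps1 s2 where ps: "ps = p # ps1" "S s s2" "p = (fst s, fst s2)" "run S s2 ps1 s'"
    using Cons.prems(2,3) by (cases ps) auto
  show ?case
  proof (cases qs)
    case Nil
    then have "S s s1" "q = (fst s, fst s1)" using Cons.prems(1) by auto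
    moreover have "s2 = s1" using right_uniqueD[OF det] \<open>S s s1\<close> ps(2) by blast
    ultimately show ?thesis using ps Nil by auto
  next
    case (Cons q' qs')
    then obtain s3 where s3: "S s s3" "q = (fst s, fst s3)" "s3 \<notin> M" "excursion S M s3 qs s1"
      using Cons.prems(1) by auto
    have "s3 = s2" using right_uniqueD[OF det] s3(1) ps(2) by blast
    then have "ps1 \<noteq> []" using s3(3) ps(4) Cons.prems(4) by auto
    then show ?thesis using Cons.IH[OF s3(4)] ps \<open>s3 = s2\<close> Cons.prems(4) s3(2) by auto
  qed
qed simp

lemma dies_no_return:
  "dies n S M s \<Longrightarrow> run S s ps s' \<Longrightarrow> ps \<noteq> [] \<Longrightarrow> s' \<notin> M"
proof (induction n arbitrary: s ps)
  case 0
  then show ?case by (cases ps) auto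
next
  case (Suc n)
  then obtain p qs s1 where "ps = p # qs" "S s s1" "run S s1 qs s'" by (cases ps) auto
  moreover have "s1 \<notin> M" "dies n S M s1" using Suc.prems(1) \<open>S s s1\<close> by (metis dies.simps(2))+
  ultimately show ?case using Suc.IH[of s1 qs] by (cases "qs = []") auto
qed

lemma run_rotate1:
  assumes "run S s ps s" "ps \<noteq> []"
  obtains s1 where "S s s1" "run S s1 (rotate1 ps) s1"
proof -
  obtain p qs s1 where "ps = p # qs" "p = (fst s, fst s1)" "S s s1" "run S s1 qs s"
    using assms by (cases ps) auto
  moreover then have "run S s [p] s1" unfolding run.simps by blast
  ultimately have "run S s1 (qs @ [p]) s1" unfolding run_append by blast
  then show ?thesis using that \<open>S s s1\<close> \<open>ps = p # qs\<close> by simp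
qed

lemma closed_run_hits:
  assumes "hits n S M s" "run S s ps s" "ps \<noteq> []"
  shows "\<exists>m s1. s1 \<in> M \<and> run S s1 (rotate m ps) s1"
  using assms
proof (induction n arbitrary: s ps)
  case 0
  then show ?case by (intro exI[of _ 0] exI[of _ s]) simp
next
  case (Suc n)
  show ?case
  proof (cases "s \<in> M")
    case True
    then show ?thesis using Suc.prems by (intro exI[of _ 0] exI[of _ s]) simp
  next
    case False
    obtain s1 where s1: "S s s1" "run S s1 (rotate1 ps) s1"
      using run_rotate1 Suc.prems(2,3) by blast
    with Suc.prems False have "hits n S M s1" "rotate1 ps \<noteq> []"
      by (metis hits.simps(2), simp)
    from Suc.IH[OF this(1) s1(2) this(2)] show ?thesis
      by (metis rotate_Suc rotate1_rotate_swap)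
  qed
qed

text \<open>
  The map \<open>E\<close> conjugates \<open>S'\<close> to the first return map of \<open>S\<close> to the section
  \<open>E ` D\<close>, and \<open>r\<close> gives the symbols read by \<open>S\<close> before the return. In all four
  sectors five steps suffice to reach the section or to run into a vertex.
\<close>

definition renormalizes ::
  "(crossing \<Rightarrow> crossing \<Rightarrow> bool) \<Rightarrow> (crossing \<Rightarrow> crossing \<Rightarrow> bool) \<Rightarrow> crossing set \<Rightarrow>
   (crossing \<Rightarrow> crossing) \<Rightarrow> (symbol \<Rightarrow> symbol list) \<Rightarrow> bool" where
  "renormalizes S S' D E r \<longleftrightarrow> inj_on E D \<and> (\<forall>s. hits 5 S (E ` D) s) \<and>
    (\<forall>t\<in>D. dies 5 S (E ` D) (E t) \<or>
      (\<exists>t1\<in>D. S' t t1 \<and> excursion S (E ` D) (E t) (r (fst t, fst t1)) (E t1)))"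

text \<open>Each return to the section removes one nonempty block \<open>r (fst t, fst t1)\<close>
  from the word, so induction on its length applies. Injectivity of \<open>E\<close> is what
  recovers \<open>t2\<close> at the end.\<close>

lemma desubstitute:
  assumes ren: "renormalizes S S' D E r"
    and det: "right_unique S"
    and "run S (E t) ps (E t2)" "t \<in> D" "t2 \<in> D"
  shows "\<exists>ps'. run S' t ps' t2 \<and> ps = concat (map r ps')"
  using assms(3-)
proof (induction ps arbitrary: t rule: length_induct)
  case (1 ps)
  show ?case
  proof (cases "ps = []")
    case True
    then have "t = t2" using 1 ren unfolding renormalizes_def inj_on_def by auto
    then show ?thesis using True by (intro exI[of _ "[]"]) simp
  next
    case False
    have "\<not> dies 5 S (E ` D) (E t)"
      using dies_no_return 1(2,4) False by blast
    then obtain t1 where t1: "t1 \<in> D" "S' t t1" 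
      and exc: "excursion S (E ` D) (E t) (r (fst t, fst t1)) (E t1)"
      using ren 1(3) unfolding renormalizes_def by blast
    obtain ps1 where ps1: "ps = r (fst t, fst t1) @ ps1" "run S (E t1) ps1 (E t2)"
      using excursion_prefix[OF det exc 1(2) False] 1(4) by auto
    have "r (fst t, fst t1) \<noteq> []" using exc by auto
    then have "length ps1 < length ps" using ps1(1) by simp
    then obtain ps' where "run S' t1 ps' t2" "ps1 = concat (map r ps')"
      using 1(1,4) ps1(2) t1(1) by blast
    then have "run S' t ((fst t, fst t1) # ps') t2" using t1(2) unfolding run.simps by blast
    then show ?thesis using ps1(1) \<open>ps1 = concat (map r ps')\<close>
      by (intro exI[of _ "(fst t, fst t1) # ps'"]) simp
  qed
qed

lemma desubstitute_closed:
  assumes ren: "renormalizes S S' D E r"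
    and det: "right_unique S"
    and "run S s ps s" "ps \<noteq> []"
  obtains m t ps' where "run S' t ps' t" "rotate m ps = concat (map r ps')"
proof -
  have "hits 5 S (E ` D) s" using ren unfolding renormalizes_def by blast
  then obtain m t where "t \<in> D" "run S (E t) (rotate m ps) (E t)"
    using closed_run_hits assms(3,4) by blast
  then show ?thesis using desubstitute[OF ren det] that by metis
qed

definition affine_embedding :: "(label \<Rightarrow> label) \<Rightarrow> (label \<Rightarrow> real) \<Rightarrow> crossing \<Rightarrow> crossing" where
  "affine_embedding m d = (\<lambda>(l, y). (m l, y + d l))"

lemma affine_embedding_Pair [simp]: "affine_embedding m d (l, y) = (m l, y + d l)"
  by (simp add: affine_embedding_def)

lemma inj_affine_embedding: "inj m \<Longrightarrow> inj_on (affine_embedding m d) D"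
  by (auto simp: inj_on_def affine_embedding_def) (metis add_right_cancel injD)+

lemma ex_label: "(\<exists>l. P l) \<longleftrightarrow> P L1 \<or> P L2 \<or> P L3 \<or> P L4 \<or> P L5"
  by (metis label.exhaust)

text \<open>Turns membership in the section into linear inequalities; the remaining quantifier over
  labels is removed by \<open>ex_label\<close>.\<close>

lemma mem_affine_embedding_image: "(x, y) \<in> affine_embedding m d ` on_sides u v U V \<longleftrightarrow>
    (\<exists>l. m l = x \<and> d l < y \<and> y < width u v U V l + d l)"
proof
  assume "\<exists>l. m l = x \<and> d l < y \<and> y < width u v U V l + d l"
  then obtain l where "m l = x" "d l < y" "y < width u v U V l + d l" by blast
  then have "(l, y - d l) \<in> on_sides u v U V" "(x, y) = affine_embedding m d (l, y - d l)" by auto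
  then show "(x, y) \<in> affine_embedding m d ` on_sides u v U V" by blast
qed auto

section \<open>Renormalization in the four sectors\<close>

text \<open>
  The parameters $(u,v,U,V)$ of the renormalized map determine those of the original one: the
  passages $xy$ of the original map have total width equal to the sum of the widths of the passages
  $p$ of the renormalized map, each counted as often as $xy$ occurs in $r_i(p)$. The side $l$
  embeds in the base of the first symbol of $r_i(l^x)$ (which does not depend on $x$), centred
  there because the half-turn commutes with the renormalization.
\<close>

primrec side0 :: "label \<Rightarrow> label" where
  "side0 L1 = L2"
| "side0 L2 = L1"
| "side0 L3 = L4"
| "side0 L4 = L3"
| "side0 L5 = L5"

primrec shift0 :: "real \<Rightarrow> real \<Rightarrow> real \<Rightarrow> real \<Rightarrow> label \<Rightarrow> real" where
  "shift0 u v U V L1 = V"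
| "shift0 u v U V L2 = 0"
| "shift0 u v U V L3 = v"
| "shift0 u v U V L4 = V"
| "shift0 u v U V L5 = 0"

primrec side1 :: "label \<Rightarrow> label" where
  "side1 L1 = L3"
| "side1 L2 = L5"
| "side1 L3 = L1"
| "side1 L4 = L4"
| "side1 L5 = L2"

primrec shift1 :: "real \<Rightarrow> real \<Rightarrow> real \<Rightarrow> real \<Rightarrow> label \<Rightarrow> real" where
  "shift1 u v U V L1 = U + V + v"
| "shift1 u v U V L2 = 0"
| "shift1 u v U V L3 = 0"
| "shift1 u v U V L4 = u + V"
| "shift1 u v U V L5 = U + V"

primrec side2 :: "label \<Rightarrow> label" where
  "side2 L1 = L4"
| "side2 L2 = L2"
| "side2 L3 = L5"
| "side2 L4 = L1"
| "side2 L5 = L3"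

primrec shift2 :: "real \<Rightarrow> real \<Rightarrow> real \<Rightarrow> real \<Rightarrow> label \<Rightarrow> real" where
  "shift2 u v U V L1 = U + V"
| "shift2 u v U V L2 = U + v"
| "shift2 u v U V L3 = 0"
| "shift2 u v U V L4 = 0"
| "shift2 u v U V L5 = U + u + V"

primrec side3 :: "label \<Rightarrow> label" where
  "side3 L1 = L1"
| "side3 L2 = L3"
| "side3 L3 = L2"
| "side3 L4 = L5"
| "side3 L5 = L4"

primrec shift3 :: "real \<Rightarrow> real \<Rightarrow> real \<Rightarrow> real \<Rightarrow> label \<Rightarrow> real" where
  "shift3 u v U V L1 = 0"
| "shift3 u v U V L2 = U"
| "shift3 u v U V L3 = u"
| "shift3 u v U V L4 = 0"
| "shift3 u v U V L5 = U"

lemma renormalizesI: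
  assumes "inj m"
    and "\<And>l y. hits 5 S (affine_embedding m d ` on_sides u v U V) (l, y)"
    and "\<And>l y. (l, y) \<in> on_sides u v U V \<Longrightarrow>
      dies 5 S (affine_embedding m d ` on_sides u v U V) (affine_embedding m d (l, y)) \<or>
      (\<exists>t. t \<in> on_sides u v U V \<and> step u v U V (l, y) t \<and>
        excursion S (affine_embedding m d ` on_sides u v U V) (affine_embedding m d (l, y))
          (r (l, fst t)) (affine_embedding m d t))"
  shows "renormalizes S (step u v U V) (on_sides u v U V) (affine_embedding m d) r"
  unfolding renormalizes_def
proof (intro conjI allI ballI)
  show "inj_on (affine_embedding m d) (on_sides u v U V)"
    using assms(1) by (rule inj_affine_embedding)
  show "hits 5 S (affine_embedding m d ` on_sides u v U V) s" for s
    using assms(2) by (cases s) simp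
next
  fix t assume "t \<in> on_sides u v U V"
  moreover obtain l y where "t = (l, y)" by fastforce
  ultimately show "dies 5 S (affine_embedding m d ` on_sides u v U V) (affine_embedding m d t) \<or>
    (\<exists>t1\<in>on_sides u v U V. step u v U V t t1 \<and>
      excursion S (affine_embedding m d ` on_sides u v U V) (affine_embedding m d t)
        (r (fst t, fst t1)) (affine_embedding m d t1))"
    using assms(3)[of l y] by auto
qed

text \<open>An instance of the count: 1^2 occurs once in the images of 2^1 and 2^3, of widths
  \<open>u\<close> and \<open>V\<close>, which gives \<open>u + V\<close>; 3^4 occurs once in those
  of 2^3, 4^3 and 4^5, which gives \<open>U + V + v\<close>.\<close>

lemma renormalization0:
  assumes "0 < u" "0 \<le> v" "0 < U" "0 \<le> V"
  shows "renormalizes (step (u + V) v (U + V + v) V) (step u v U V) (on_sides u v U V)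
    (affine_embedding side0 (shift0 u v U V)) r0"
proof (rule renormalizesI)
  show "inj side0"
    by (rule injI, rename_tac x y, case_tac x; case_tac y) auto
  fix l y
  show "hits 5 (step (u + V) v (U + V + v) V)
    (affine_embedding side0 (shift0 u v U V) ` on_sides u v U V) (l, y)"
    \<comment> \<open>For a numeral depth, \<open>hits\<close> unfolds by \<open>step_simps\<close>
      into finitely many linear inequalities in \<open>y\<close> on each side; \<open>dies\<close>
      and the return words below are treated alike.\<close>
    using assms by (cases l) (auto simp: mem_affine_embedding_image ex_label eval_nat_numeral)
  assume "(l, y) \<in> on_sides u v U V"
  with assms show "dies 5 (step (u + V) v (U + V + v) V)
      (affine_embedding side0 (shift0 u v U V) ` on_sides u v U V)
      (affine_embedding side0 (shift0 u v U V) (l, y)) \<or>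
    (\<exists>t. t \<in> on_sides u v U V \<and> step u v U V (l, y) t \<and>
      excursion (step (u + V) v (U + V + v) V)
        (affine_embedding side0 (shift0 u v U V) ` on_sides u v U V)
        (affine_embedding side0 (shift0 u v U V) (l, y)) (r0 (l, fst t))
        (affine_embedding side0 (shift0 u v U V) t))"
    by (cases l) (auto simp: mem_affine_embedding_image ex_label eval_nat_numeral)
qed

lemma renormalization1:
  assumes "0 < u" "0 \<le> v" "0 < U" "0 \<le> V"
  shows "renormalizes (step (U + V) (u + V) (U + u + V + v) (U + V + v)) (step u v U V) (on_sides u v U V)
    (affine_embedding side1 (shift1 u v U V)) r1"
proof (rule renormalizesI)
  show "inj side1"
    by (rule injI, rename_tac x y, case_tac x; case_tac y) auto
  fix l y
  show "hits 5 (step (U + V) (u + V) (U + u + V + v) (U + V + v))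
    (affine_embedding side1 (shift1 u v U V) ` on_sides u v U V) (l, y)"
    using assms by (cases l) (auto simp: mem_affine_embedding_image ex_label eval_nat_numeral)
  assume "(l, y) \<in> on_sides u v U V"
  with assms show "dies 5 (step (U + V) (u + V) (U + u + V + v) (U + V + v))
      (affine_embedding side1 (shift1 u v U V) ` on_sides u v U V)
      (affine_embedding side1 (shift1 u v U V) (l, y)) \<or>
    (\<exists>t. t \<in> on_sides u v U V \<and> step u v U V (l, y) t \<and>
      excursion (step (U + V) (u + V) (U + u + V + v) (U + V + v))
        (affine_embedding side1 (shift1 u v U V) ` on_sides u v U V)
        (affine_embedding side1 (shift1 u v U V) (l, y)) (r1 (l, fst t))
        (affine_embedding side1 (shift1 u v U V) t))"
    by (cases l) (auto simp: mem_affine_embedding_image ex_label eval_nat_numeral)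
qed

text \<open>Relabelling l as 6 - l and exchanging \<open>u\<close> with \<open>v\<close> and
  \<open>U\<close> with \<open>V\<close> turns r1 and its parameters into r2 and these; r0 and r3
  correspond in the same way.\<close>

lemma renormalization2:
  assumes "0 < u" "0 \<le> v" "0 < U" "0 \<le> V"
  shows "renormalizes (step (U + v) (U + V) (U + u + V) (U + u + V + v)) (step u v U V) (on_sides u v U V)
    (affine_embedding side2 (shift2 u v U V)) r2"
proof (rule renormalizesI)
  show "inj side2"
    by (rule injI, rename_tac x y, case_tac x; case_tac y) auto
  fix l y
  show "hits 5 (step (U + v) (U + V) (U + u + V) (U + u + V + v))
    (affine_embedding side2 (shift2 u v U V) ` on_sides u v U V) (l, y)"
    using assms by (cases l) (auto simp: mem_affine_embedding_image ex_label eval_nat_numeral)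
  assume "(l, y) \<in> on_sides u v U V"
  with assms show "dies 5 (step (U + v) (U + V) (U + u + V) (U + u + V + v))
      (affine_embedding side2 (shift2 u v U V) ` on_sides u v U V)
      (affine_embedding side2 (shift2 u v U V) (l, y)) \<or>
    (\<exists>t. t \<in> on_sides u v U V \<and> step u v U V (l, y) t \<and>
      excursion (step (U + v) (U + V) (U + u + V) (U + u + V + v))
        (affine_embedding side2 (shift2 u v U V) ` on_sides u v U V)
        (affine_embedding side2 (shift2 u v U V) (l, y)) (r2 (l, fst t))
        (affine_embedding side2 (shift2 u v U V) t))"
    by (cases l) (auto simp: mem_affine_embedding_image ex_label eval_nat_numeral)
qed

lemma renormalization3:
  assumes "0 < u" "0 \<le> v" "0 < U" "0 \<le> V"
  shows "renormalizes (step u (U + v) U (U + u + V)) (step u v U V) (on_sides u v U V)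
    (affine_embedding side3 (shift3 u v U V)) r3"
proof (rule renormalizesI)
  show "inj side3"
    by (rule injI, rename_tac x y, case_tac x; case_tac y) auto
  fix l y
  show "hits 5 (step u (U + v) U (U + u + V))
    (affine_embedding side3 (shift3 u v U V) ` on_sides u v U V) (l, y)"
    using assms by (cases l) (auto simp: mem_affine_embedding_image ex_label eval_nat_numeral)
  assume "(l, y) \<in> on_sides u v U V"
  with assms show "dies 5 (step u (U + v) U (U + u + V))
      (affine_embedding side3 (shift3 u v U V) ` on_sides u v U V)
      (affine_embedding side3 (shift3 u v U V) (l, y)) \<or>
    (\<exists>t. t \<in> on_sides u v U V \<and> step u v U V (l, y) t \<and>
      excursion (step u (U + v) U (U + u + V))
        (affine_embedding side3 (shift3 u v U V) ` on_sides u v U V)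
        (affine_embedding side3 (shift3 u v U V) (l, y)) (r3 (l, fst t))
        (affine_embedding side3 (shift3 u v U V) t))"
    by (cases l) (auto simp: mem_affine_embedding_image ex_label eval_nat_numeral)
qed

section \<open>Strict shortening of closed words\<close>

lemma run_mono: 
  assumes "run S s ps s'" and "\<And>s s1. S s s1 \<Longrightarrow> (fst s, fst s1) \<in> set ps \<Longrightarrow> g s1 < (g s :: real)"
  shows "g s' \<le> g s" and "ps \<noteq> [] \<Longrightarrow> g s' < g s"
proof -
  have "g s' \<le> g s \<and> (ps \<noteq> [] \<longrightarrow> g s' < g s)"
    using assms
  proof (induction ps arbitrary: s)
    case (Cons p ps)
    obtain s1 where s1: "S s s1" "p = (fst s, fst s1)" "run S s1 ps s'" using Cons.prems(1) by auto
    have "g s1 < g s" using Cons.prems(2) s1 by auto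
    moreover have "g s' \<le> g s1" using Cons.IH[OF s1(3)] Cons.prems(2) by auto
    ultimately show ?case by simp
  qed auto
  then show "g s' \<le> g s" and "ps \<noteq> [] \<Longrightarrow> g s' < g s" by auto
qed

lemma run_symbols:
  assumes "run (step u v U V) s ps s'" "p \<in> set ps"
  shows "p \<in> {(L1,L2), (L2,L1), (L2,L3), (L3,L2), (L3,L4), (L4,L3), (L4,L5), (L5,L4)}"
  using assms
proof (induction ps arbitrary: s)
  case (Cons q ps)
  then obtain s1 where "step u v U V s s1" "q = (fst s, fst s1)" "run (step u v U V) s1 ps s'"
    by auto
  moreover from this(1) have
    "(fst s, fst s1) \<in> {(L1,L2), (L2,L1), (L2,L3), (L3,L2), (L3,L4), (L4,L3), (L4,L5), (L5,L4)}"
    by cases simp_all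
  ultimately show ?case using Cons.IH[of s1] Cons.prems(2) by (metis set_ConsD)
qed simp

lemma substitution_nonempty:
  assumes "run (step u v U V) s ps s'" "p \<in> set ps" "r \<in> {r0, r1, r2, r3}"
  shows "r p \<noteq> []"
  using run_symbols[OF assms(1,2)] assms(3) by auto

text \<open>The symbols with one-letter images are 1^2, 2^1, 3^4, 4^3. Along them the coordinate
  never grows, and it drops at least at every second step, so they cannot close up by themselves.
  For v = V = 0 they do, as the seeds show.\<close>

lemma closed_run_long_symbol0:
  assumes "run (step u v U V) s ps s" "ps \<noteq> []" "0 < v" "0 < V"
  shows "\<exists>p\<in>set ps. 2 \<le> length (r0 p)"
proof (rule ccontr)
  assume short: "\<not> ?thesis"
  \<comment> \<open>Without the term \<open>V / 2\<close> the passage from side 1 to side 2 would leave \<open>g\<close> unchanged.\<close>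
  define g where "g = (\<lambda>(l, y). if l = L2 then y - V / 2 else y)"
  have "g s1 < g s" if "step u v U V s s1" "(fst s, fst s1) \<in> set ps" for s s1
    using that(1)
  proof cases
  qed (use that(2) short assms(3,4) in \<open>force simp: g_def\<close>)+
  then show False using run_mono(2)[OF assms(1), of g] assms(2) by auto
qed

lemma closed_run_long_symbol3:
  assumes "run (step u v U V) s ps s" "ps \<noteq> []" "0 < u" "0 < U"
  shows "\<exists>p\<in>set ps. 2 \<le> length (r3 p)"
proof (rule ccontr)
  assume short: "\<not> ?thesis"
  \<comment> \<open>Here the one-letter images belong to 2^3, 3^2, 4^5, 5^4, along which the
    coordinate grows, except that 4^5 keeps it; the term \<open>U / 2\<close> on side 5 makes up for
    that.\<close>
  define g where "g = (\<lambda>(l, y). if l = L5 then - y - U / 2 else - y)"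
  have "g s1 < g s" if "step u v U V s s1" "(fst s, fst s1) \<in> set ps" for s s1
    using that(1)
  proof cases
  qed (use that(2) short assms(3,4) in \<open>force simp: g_def\<close>)+
  then show False using run_mono(2)[OF assms(1), of g] assms(2) by auto
qed

lemma closed_run_long_symbol:
  assumes "run (step u v U V) s ps s" "ps \<noteq> []" "0 < u" "0 < U"
    and "r \<in> {r1, r2, r3} \<or> r = r0 \<and> 0 < v \<and> 0 < V"
  shows "\<exists>p\<in>set ps. 2 \<le> length (r p)"
proof -
  have "\<exists>p\<in>set ps. 2 \<le> length (r p)" if r: "r \<in> {r1, r2}"
  proof -
    obtain p where "p \<in> set ps" using assms(2) by (cases ps) auto
    moreover from this have "2 \<le> length (r p)" using run_symbols[OF assms(1), of p] r by auto
    ultimately show ?thesis by blast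
  qed
  then show ?thesis
    using assms(2-) closed_run_long_symbol0[OF assms(1)] closed_run_long_symbol3[OF assms(1)] by auto
qed

text \<open>With U = phi u and V = phi v the four renormalizations are linear in (u', v'); the
  chosen u', v' invert them. The images of the region u' > 0, v' >= 0 meet along the rays where v /
  u is 1 / phi, 1 and phi.\<close>

lemma sector:
  fixes u v \<phi> :: real
  assumes "0 < u" "0 < v" and \<phi>: "1 < \<phi>" "\<phi> * \<phi> = \<phi> + 1"
  obtains u' v' r E where "0 < u'" "0 \<le> v'" "r \<in> {r1, r2, r3} \<or> r = r0 \<and> 0 < v'"
    "renormalizes (step u v (\<phi> * u) (\<phi> * v)) (step u' v' (\<phi> * u') (\<phi> * v'))
      (on_sides u' v' (\<phi> * u') (\<phi> * v')) E r"
proof -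
  have pos: "0 < \<phi> * x \<longleftrightarrow> 0 < x" "0 \<le> \<phi> * x \<longleftrightarrow> 0 \<le> x" for x
    using \<phi>(1) by (simp_all add: zero_less_mult_iff zero_le_mult_iff)
  have sq: "\<phi> * (\<phi> * x) = \<phi> * x + x" for x
    using \<phi>(2) by (metis distrib_right mult.assoc mult_1)
  \<comment> \<open>Each separating ray goes to the sector with the larger v / u, where it becomes
    v' = 0; in the other sector it would give u' = 0.\<close>
  consider "\<phi> * v < u" | "u \<le> \<phi> * v" "v < u" | "u \<le> v" "v < \<phi> * u" | "\<phi> * u \<le> v" by linarith
  then show thesis
  proof cases
    case 1
    define u' where "u' = u - \<phi> * v"
    have pos': "0 < u'" using 1 by (simp add: u'_def)
    moreover have "u' + \<phi> * v = u" "\<phi> * u' + \<phi> * v + v = \<phi> * u"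
      by (simp_all add: u'_def sq algebra_simps)
    ultimately have "renormalizes (step u v (\<phi> * u) (\<phi> * v)) (step u' v (\<phi> * u') (\<phi> * v))
        (on_sides u' v (\<phi> * u') (\<phi> * v))
        (affine_embedding side0 (shift0 u' v (\<phi> * u') (\<phi> * v))) r0"
      using renormalization0[of u' v "\<phi> * u'" "\<phi> * v"] assms(1,2) pos by simp
    then show thesis
      using pos' assms(1,2) by (intro that) auto
  next
    case 2
    define u' v' where "u' = \<phi> * (u - v)" and "v' = \<phi> * v - u"
    have pos': "0 < u'" "0 \<le> v'" using 2 pos by (simp_all add: u'_def v'_def)
    moreover have "\<phi> * u' + \<phi> * v' = u" "u' + \<phi> * v' = v" "\<phi> * u' + u' + \<phi> * v' + v' = \<phi> * u"
      "\<phi> * u' + \<phi> * v' + v' = \<phi> * v"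
      by (simp_all add: u'_def v'_def sq algebra_simps)
    ultimately have "renormalizes (step u v (\<phi> * u) (\<phi> * v)) (step u' v' (\<phi> * u') (\<phi> * v'))
        (on_sides u' v' (\<phi> * u') (\<phi> * v'))
        (affine_embedding side1 (shift1 u' v' (\<phi> * u') (\<phi> * v'))) r1"
      using renormalization1[of u' v' "\<phi> * u'" "\<phi> * v'"] assms(1,2) pos by simp
    then show thesis
      using pos' assms(1,2) by (intro that) auto
  next
    case 3
    define u' v' where "u' = \<phi> * u - v" and "v' = \<phi> * (v - u)"
    have pos': "0 < u'" "0 \<le> v'" using 3 pos by (simp_all add: u'_def v'_def)
    moreover have "\<phi> * u' + v' = u" "\<phi> * u' + \<phi> * v' = v" "\<phi> * u' + u' + \<phi> * v' = \<phi> * u"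
      "\<phi> * u' + u' + \<phi> * v' + v' = \<phi> * v"
      by (simp_all add: u'_def v'_def sq algebra_simps)
    ultimately have "renormalizes (step u v (\<phi> * u) (\<phi> * v)) (step u' v' (\<phi> * u') (\<phi> * v'))
        (on_sides u' v' (\<phi> * u') (\<phi> * v'))
        (affine_embedding side2 (shift2 u' v' (\<phi> * u') (\<phi> * v'))) r2"
      using renormalization2[of u' v' "\<phi> * u'" "\<phi> * v'"] assms(1,2) pos by simp
    then show thesis
      using pos' assms(1,2) by (intro that) auto
  next
    case 4
    define v' where "v' = v - \<phi> * u"
    have pos': "0 \<le> v'" using 4 by (simp add: v'_def)
    moreover have "\<phi> * u + v' = v" "\<phi> * u + u + \<phi> * v' = \<phi> * v"
      by (simp_all add: v'_def sq algebra_simps)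
    ultimately have "renormalizes (step u v (\<phi> * u) (\<phi> * v)) (step u v' (\<phi> * u) (\<phi> * v'))
        (on_sides u v' (\<phi> * u) (\<phi> * v'))
        (affine_embedding side3 (shift3 u v' (\<phi> * u) (\<phi> * v'))) r3"
      using renormalization3[of u v' "\<phi> * u" "\<phi> * v'"] assms(1,2) pos by simp
    then show thesis
      using pos' assms(1,2) by (intro that) auto
  qed
qed

section \<open>The horizontal direction and its two cylinders\<close>

lemma horizontal_step:
  assumes "step u 0 U 0 s s1" "step u 0 U 0 s1 s2"
  shows "s2 = s" and "fst s1 \<noteq> fst s"
    and "[(fst s, fst s1), (fst s1, fst s)] \<in>
      {[(L1, L2), (L2, L1)], [(L2, L1), (L1, L2)], [(L3, L4), (L4, L3)], [(L4, L3), (L3, L4)]}"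
proof -
  obtain l y where s: "s = (l, y)" by fastforce
  show "s2 = s" "fst s1 \<noteq> fst s" "[(fst s, fst s1), (fst s1, fst s)] \<in>
      {[(L1, L2), (L2, L1)], [(L2, L1), (L1, L2)], [(L3, L4), (L4, L3)], [(L4, L3), (L3, L4)]}"
    \<comment> \<open>For v = V = 0 only the strips between 1 and 2 and between 3 and 4 remain, and
      there each step is undone by the next.\<close>
    using assms unfolding s by (cases l; auto)+
qed

lemma horizontal_closed_run:
  assumes "run (step u 0 U 0) s ps s" "step u 0 U 0 s s1"
  shows "\<exists>m. ps = concat (replicate m [(fst s, fst s1), (fst s1, fst s)])"
  using assms(1)
proof (induction ps rule: length_induct)
  case (1 ps)
  show ?case
  proof (cases ps)
    case Nil
    then show ?thesis by (intro exI[of _ 0]) simp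
  next
    case (Cons p ps')
    then obtain s1' where "p = (fst s, fst s1')" "step u 0 U 0 s s1'" "run (step u 0 U 0) s1' ps' s"
      using 1(2) by auto
    moreover from this have "s1' = s1"
      using right_uniqueD[OF right_unique_step] assms(2) by blast
    ultimately have p: "p = (fst s, fst s1)" "run (step u 0 U 0) s1 ps' s" by auto
    have "ps' \<noteq> []"
    proof
      assume "ps' = []"
      then have "step u 0 U 0 s s" using p assms(2) by simp
      then show False using horizontal_step(2) by blast
    qed
    then obtain q ps'' s2 where q: "ps' = q # ps''" "q = (fst s1, fst s2)" "step u 0 U 0 s1 s2"
      "run (step u 0 U 0) s2 ps'' s"
      using p(2) by (cases ps') auto
    have "s2 = s" using horizontal_step(1)[OF assms(2) q(3)] .
    then obtain m where "ps'' = concat (replicate m [(fst s, fst s1), (fst s1, fst s)])"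
      using 1(1)[rule_format, of ps''] q Cons by auto
    then show ?thesis using Cons p q \<open>s2 = s\<close> by (intro exI[of _ "Suc m"]) simp
  qed
qed

lemma horizontal_closed_run_substitution_word:
  assumes run: "run (step u 0 U 0) s ps s" and "ps \<noteq> []" "primitive ps"
  shows "\<exists>x\<in>substitution_words. cyclic_shift ps x"
proof -
  obtain s1 where s1: "step u 0 U 0 s s1" "run (step u 0 U 0) s1 (rotate1 ps) s1"
    using run_rotate1 run assms(2) by blast
  obtain s2 where s2: "step u 0 U 0 s1 s2"
    using run_rotate1[OF s1(2)] assms(2) by (metis rotate1_is_Nil_conv)
  define w where "w = [(fst s, fst s1), (fst s1, fst s)]"
  obtain m where m: "ps = concat (replicate m w)"
    using horizontal_closed_run[OF run s1(1)] w_def by blast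
  \<comment> \<open>A second copy of \<open>w\<close> would make the rotation by
    \<open>length w\<close> fix \<open>ps\<close>; \<open>m = 0\<close> would make \<open>ps\<close>
    empty.\<close>
  have "m = 1"
  proof (rule ccontr)
    assume "m \<noteq> 1"
    then obtain k where k: "m = Suc (Suc k)" using m assms(2) by (cases m; cases "m - 1") auto
    have "ps = w @ concat (replicate (Suc k) w)" using m k by simp
    moreover have "ps = concat (replicate (Suc k) w) @ w"
      using m k by (metis concat_append concat.simps append_Nil2 replicate_append_same replicate_Suc)
    ultimately have "rotate (length w) ps = ps" by (metis rotate_append)
    moreover have "0 < length w" "length w < length ps"
      using m k by (simp_all add: w_def)
    ultimately show False using assms(3) unfolding primitive_def by blast
  qed
  then have "ps \<in> {[(L1, L2), (L2, L1)], [(L2, L1), (L1, L2)], [(L3, L4), (L4, L3)], [(L4, L3), (L3, L4)]}"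
    using m horizontal_step(3)[OF s1(1) s2] by (simp add: w_def)
  moreover have "cyclic_shift [a, b] [a, b]" "cyclic_shift [a, b] [b, a]" for a b :: symbol
    using cyclic_shift_append[of "[]" "[a, b]"] cyclic_shift_append[of "[a]" "[b]"] by simp_all
  ultimately show ?thesis
    by (auto intro: bexI[OF _ short_seed] bexI[OF _ long_seed])
qed

text \<open>After a rotation the closed orbit starts in the section and desubstitutes to a shorter
  closed orbit. Primitivity passes down to the shorter word, and the cyclic shift to a substitution
  word passes back up through \<open>r\<close>.\<close>

lemma closed_run_substitution_word:
  fixes u v \<phi> :: real
  assumes \<phi>: "1 < \<phi>" "\<phi> * \<phi> = \<phi> + 1"
    and "0 < u" "0 \<le> v" and "run (step u v (\<phi> * u) (\<phi> * v)) s ps s" "ps \<noteq> []" "primitive ps"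
  shows "\<exists>x\<in>substitution_words. cyclic_shift ps x"
  using assms(3-)
proof (induction ps arbitrary: u v s rule: length_induct)
  case (1 ps)
  show ?case
  proof (cases "v = 0")
    case True
    then have "run (step u 0 (\<phi> * u) 0) s ps s" using 1 by simp
    then show ?thesis using horizontal_closed_run_substitution_word[of u "\<phi> * u" s ps] 1(5,6) by simp
  next
    case False
    then have "0 < v" using 1 by simp
    obtain u' v' r E where uv': "0 < u'" "0 \<le> v'" "r \<in> {r1, r2, r3} \<or> r = r0 \<and> 0 < v'"
      and ren: "renormalizes (step u v (\<phi> * u) (\<phi> * v)) (step u' v' (\<phi> * u') (\<phi> * v'))
        (on_sides u' v' (\<phi> * u') (\<phi> * v')) E r"
      by (rule sector[OF 1(2) \<open>0 < v\<close> \<phi>])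
    have r: "r \<in> {r0, r1, r2, r3}" using uv'(3) by blast
    obtain m t ps' where t: "run (step u' v' (\<phi> * u') (\<phi> * v')) t ps' t" 
      and ps': "rotate m ps = concat (map r ps')"
      by (rule desubstitute_closed[OF ren right_unique_step 1(4,5)])
    have ne: "r p \<noteq> []" if "p \<in> set ps'" for p
      using substitution_nonempty[OF t that r] .
    have "ps' \<noteq> []" using ps' 1(5) by (metis concat.simps(1) list.map(1) rotate_is_Nil_conv)
    have "primitive ps'"
      using primitive_of_concat_map[of r ps'] ne primitive_rotate[OF 1(6), of m] ps' by simp
    have "0 < \<phi> * u'" "0 < v' \<Longrightarrow> 0 < \<phi> * v'" using uv'(1) \<phi>(1) by simp_all
    then have "\<exists>p\<in>set ps'. 2 \<le> length (r p)"
      using closed_run_long_symbol[OF t \<open>ps' \<noteq> []\<close> uv'(1)] uv'(3) by blast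
    with ne have "length ps' < length (concat (map r ps'))"
      by (rule length_concat_map_less)
    also have "\<dots> = length ps" using ps' by (metis length_rotate)
    finally obtain x where x: "x \<in> substitution_words" "cyclic_shift ps' x"
      using 1(1)[rule_format, of ps'] uv'(1,2) t \<open>ps' \<noteq> []\<close> \<open>primitive ps'\<close> by blast
    have "cyclic_shift ps (concat (map r ps'))"
      unfolding cyclic_shift_def using ps' by metis
    then have "cyclic_shift ps (concat (map r x))"
      using cyclic_shift_concat_map[OF x(2)] cyclic_shift_trans by blast
    then show ?thesis using substitution_words.substitute[OF x(1) r] by blast
  qed
qed

section \<open>Geometry of the pentagon\<close>

definition golden :: real where
  "golden = 2 * cos (pi / 5)"

text \<open>For x = pi / 5 one has 3 x = pi - 2 x, so sin (3 x) = sin (2 x). Division by sin x gives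
  4 c c - 1 = 2 c with c = cos x, the equation of the golden ratio for 2 c.\<close>

lemma golden_gt_1: "1 < golden"
  and golden_square: "golden * golden = golden + 1"
proof -
  have "cos (pi / 3) < cos (pi / 5)" by (rule cos_monotone_0_pi) auto
  then show "1 < golden" by (simp add: golden_def cos_60)
  let ?s = "sin (pi / 5)" and ?c = "cos (pi / 5)"
  have s: "0 < ?s" by (rule sin_gt_zero) auto
  have "sin (2 * (pi / 5) + pi / 5) = sin (pi - 2 * (pi / 5))"
    by (rule arg_cong[of _ _ sin]) simp
  then have "sin (2 * (pi / 5) + pi / 5) = sin (2 * (pi / 5))"
    unfolding sin_pi_minus .
  then have "sin (2 * (pi / 5)) * ?c + cos (2 * (pi / 5)) * ?s = 2 * ?s * ?c"
    unfolding sin_add sin_double .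
  then have "?s * (2 * ?c * ?c + cos (2 * (pi / 5))) = ?s * (2 * ?c)"
    unfolding sin_double by (simp add: algebra_simps)
  then have "2 * ?c * ?c + cos (2 * (pi / 5)) = 2 * ?c" using s by simp
  then show "golden * golden = golden + 1"
    unfolding golden_def cos_double_cos by (simp add: power2_eq_square)
qed

section \<open>Height across a flow, and the position of the pentagon relative to its sides\<close>

definition height :: "real \<Rightarrow> complex \<Rightarrow> real" where
  "height \<theta> z = Im (z * cis (- \<theta>))"

lemma height_add: "height \<theta> (z + w) = height \<theta> z + height \<theta> w"
  and height_minus: "height \<theta> (- z) = - height \<theta> z"
  and height_of_real: "height \<theta> (complex_of_real t * z) = t * height \<theta> z"
  by (simp_all add: height_def algebra_simps)

lemma height_scaleR: "height \<theta> (t *\<^sub>R z) = t * height \<theta> z"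
  by (simp add: scaleR_conv_of_real height_of_real)

lemma height_cis: "height \<theta> (cis \<alpha>) = sin (\<alpha> - \<theta>)"
  by (simp add: height_def cis_mult)

lemma height_inner: "height \<theta> z = (\<i> * cis \<theta>) \<bullet> z"
  by (simp add: height_def inner_complex_def algebra_simps)

lemma pentagon_vertex_Suc:
  "pentagon_vertex (Suc k) = pentagon_vertex k + complex_of_real (2 * sin (pi / 5)) * cis (2 * pi * real k / 5)"
proof -
  \<comment> \<open>The outward normal of side \<open>k\<close>; the end points of the side lie at
    angle pi / 5 from it on either side.\<close>
  let ?x = "2 * pi * real k / 5 - pi / 2"
  have 1: "2 * pi * real (Suc k) / 5 - 7 * pi / 10 = ?x + pi / 5"
    and 2: "2 * pi * real k / 5 - 7 * pi / 10 = ?x - pi / 5"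
    by (simp_all add: field_simps)
  have cos_eq: "cos (a - pi / 2 + b) = cos (a - pi / 2 - b) + 2 * sin b * cos a"
    and sin_eq: "sin (a - pi / 2 + b) = sin (a - pi / 2 - b) + 2 * sin b * sin a" for a b :: real
    by (simp_all add: cos_add cos_diff sin_add sin_diff)
  show ?thesis
    unfolding pentagon_vertex_def 1 2 complex_eq_iff
    using cos_eq[of "2 * pi * real k / 5" "pi / 5"] sin_eq[of "2 * pi * real k / 5" "pi / 5"] by simp
qed

lemma height_vertex: "height \<theta> (pentagon_vertex k) = sin (2 * pi * real k / 5 - 7 * pi / 10 - \<theta>)"
  by (simp add: pentagon_vertex_def height_cis)

lemma height_vertex_Suc:
  "height \<theta> (pentagon_vertex (Suc k)) =
     height \<theta> (pentagon_vertex k) + 2 * sin (pi / 5) * sin (2 * pi * real k / 5 - \<theta>)"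
  unfolding pentagon_vertex_Suc height_add height_of_real height_cis by simp

text \<open>Side k has direction 2 pi k / 5, and the edge angle is j pi / 5; the value solves 2 k =
  j modulo 5, since parallelism only sees directions modulo pi.\<close>

primrec side_index :: "label \<Rightarrow> nat" where
  "side_index L1 = 3"
| "side_index L2 = 2"
| "side_index L3 = 4"
| "side_index L4 = 1"
| "side_index L5 = 0"

lemma sin_multiple_eq_0_iff: "sin (real_of_int j * pi / 5) = 0 \<longleftrightarrow> 5 dvd j"
proof -
  have "sin (real_of_int j * pi / 5) = 0 \<longleftrightarrow> (\<exists>i::int. real_of_int j * pi / 5 = real_of_int i * pi)"
    by (rule sin_zero_iff_int2)
  also have "\<dots> \<longleftrightarrow> (\<exists>i::int. real_of_int j = real_of_int (5 * i))"
    by (simp add: field_simps)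
  also have "\<dots> \<longleftrightarrow> 5 dvd j" unfolding of_int_eq_iff dvd_def ..
  finally show ?thesis .
qed

lemma cis_proportional_iff:
  assumes "c \<noteq> 0"
  shows "(\<exists>t. complex_of_real c * cis a = complex_of_real t * cis b) \<longleftrightarrow> sin (a - b) = 0"
proof
  assume "\<exists>t. complex_of_real c * cis a = complex_of_real t * cis b"
  then obtain t where "complex_of_real c * cis a = complex_of_real t * cis b" by blast
  then have "height b (complex_of_real c * cis a) = height b (complex_of_real t * cis b)" by simp
  then show "sin (a - b) = 0" using assms by (simp add: height_of_real height_cis)
next
  assume "sin (a - b) = 0"
  then have "cis (a - b) = complex_of_real (cos (a - b))" by (simp add: complex_eq_iff)
  then have "complex_of_real (c * cos (a - b)) * cis b = complex_of_real c * (cis (a - b) * cis b)"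
    by simp
  also have "\<dots> = complex_of_real c * cis a" unfolding cis_mult by simp
  finally show "\<exists>t. complex_of_real c * cis a = complex_of_real t * cis b" by metis
qed

lemma sin_pi_5_pos: "0 < sin (pi / 5)"
  by (rule sin_gt_zero) auto

lemma parallel_side_iff:
  assumes "k < 5"
  shows "(\<exists>t. pentagon_vertex (Suc k) - pentagon_vertex k = complex_of_real t * cis (edge_angle l))
    \<longleftrightarrow> k = side_index l"
proof -
  obtain j :: int where j: "edge_angle l = real_of_int j * pi / 5"
    and dvd: "5 dvd (2 * int k - j) \<longleftrightarrow> k = side_index l"
  proof (cases l)
    case L1
    show thesis by (rule that[of 1]) (use L1 in simp, use L1 assms in \<open>simp, presburger\<close>)
  next
    case L2
    show thesis by (rule that[of 4]) (use L2 in simp, use L2 assms in \<open>simp, presburger\<close>)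
  next
    case L3
    show thesis by (rule that[of 3]) (use L3 in simp, use L3 assms in \<open>simp, presburger\<close>)
  next
    case L4
    show thesis by (rule that[of 2]) (use L4 in simp, use L4 assms in \<open>simp, presburger\<close>)
  next
    case L5
    show thesis by (rule that[of 0]) (use L5 in simp, use L5 assms in \<open>simp, presburger\<close>)
  qed
  have "2 * pi * real k / 5 - edge_angle l = real_of_int (2 * int k - j) * pi / 5"
    by (simp add: j field_simps)
  moreover have "(\<exists>t. pentagon_vertex (Suc k) - pentagon_vertex k = complex_of_real t * cis (edge_angle l))
      \<longleftrightarrow> sin (2 * pi * real k / 5 - edge_angle l) = 0"
    unfolding pentagon_vertex_Suc add_diff_cancel_left'
    by (rule cis_proportional_iff) (use sin_pi_5_pos in simp)
  ultimately show ?thesis using dvd sin_multiple_eq_0_iff by metis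
qed

lemma side_index_less: "side_index l < 5"
  by (cases l) auto

lemma pentagon_side_eq:
  "pentagon_side l =
    open_segment (pentagon_vertex (side_index l)) (pentagon_vertex (Suc (side_index l)))"
proof -
  have "{open_segment (pentagon_vertex k) (pentagon_vertex (Suc k)) | k.
          k < 5 \<and> (\<exists>t. pentagon_vertex (Suc k) - pentagon_vertex k
                         = complex_of_real t * cis (edge_angle l))} =
    {open_segment (pentagon_vertex k) (pentagon_vertex (Suc k)) | k. k = side_index l}"
    using parallel_side_iff[of _ l] side_index_less[of l] by blast
  then show ?thesis unfolding pentagon_side_def by simp
qed

lemma cos_le_cos:
  assumes "0 \<le> a" "a \<le> x" "x \<le> 2 * pi - a"
  shows "cos x \<le> cos a"
proof (cases "x \<le> pi")
  case True
  then show ?thesis using assms by (intro cos_monotone_0_pi_le) auto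
next
  case False
  then have "cos (2 * pi - x) \<le> cos a" using assms by (intro cos_monotone_0_pi_le) auto
  then show ?thesis by (simp add: cos_diff)
qed

lemma cos_odd_multiple_le:
  assumes "- 5 \<le> i" "i \<le> 4"
  shows "cos (real_of_int (2 * i + 1) * pi / 5) \<le> cos (pi / 5)"
proof -
  define n where "n = \<bar>2 * i + 1\<bar>"
  have "1 \<le> n" "n \<le> 9" using assms unfolding n_def by presburger+
  then have "1 * pi / 5 \<le> real_of_int n * pi / 5" "real_of_int n * pi / 5 \<le> 9 * pi / 5"
    by (intro divide_right_mono mult_right_mono; simp)+
  then have "cos (real_of_int n * pi / 5) \<le> cos (pi / 5)"
    by (intro cos_le_cos) auto
  moreover have "real_of_int n * pi / 5 = \<bar>real_of_int (2 * i + 1) * pi / 5\<bar>"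
    by (simp add: n_def abs_mult)
  ultimately show ?thesis by (simp only: cos_abs_real)
qed

text \<open>\<open>cos (pi / 5)\<close> is the inradius: the line of side \<open>k\<close> has this
  distance from the centre, and the whole pentagon lies on one side of it.\<close>

lemma height_vertex_ge:
  assumes "j < 5" "k < 5"
  shows "- cos (pi / 5) \<le> height (2 * pi * real k / 5) (pentagon_vertex j)"
proof -
  let ?i = "int j - int k - 1"
  have "height (2 * pi * real k / 5) (pentagon_vertex j) = - cos (real_of_int (2 * ?i + 1) * pi / 5)"
  proof -
    have "2 * pi * real j / 5 - 7 * pi / 10 - 2 * pi * real k / 5 = real_of_int (2 * ?i + 1) * pi / 5 - pi / 2"
      by (simp add: field_simps)
    then show ?thesis unfolding height_vertex by (simp add: sin_diff)
  qed
  moreover have "- 5 \<le> ?i" "?i \<le> 4" using assms by auto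
  ultimately show ?thesis using cos_odd_multiple_le[of ?i] by simp
qed

lemma height_side:
  assumes "z \<in> pentagon_side l"
  shows "height (2 * pi * real (side_index l) / 5) z = - cos (pi / 5)"
proof -
  let ?k = "side_index l"
  obtain s where z: "z = (1 - s) *\<^sub>R pentagon_vertex ?k + s *\<^sub>R pentagon_vertex (Suc ?k)"
    using assms unfolding pentagon_side_eq in_segment by blast
  have "height (2 * pi * real ?k / 5) (pentagon_vertex ?k) = - cos (pi / 5)"
  proof -
    have "2 * pi * real ?k / 5 - 7 * pi / 10 - 2 * pi * real ?k / 5 = - (pi / 5) - pi / 2"
      by (simp add: field_simps)
    then show ?thesis unfolding height_vertex by (simp only: sin_diff) simp
  qed
  moreover have "height (2 * pi * real ?k / 5) (pentagon_vertex (Suc ?k)) =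
      height (2 * pi * real ?k / 5) (pentagon_vertex ?k)"
    unfolding height_vertex_Suc by simp
  moreover have "height (2 * pi * real ?k / 5) z =
      (1 - s) * height (2 * pi * real ?k / 5) (pentagon_vertex ?k) +
      s * height (2 * pi * real ?k / 5) (pentagon_vertex (Suc ?k))"
    by (simp only: z height_add height_scaleR)
  ultimately show ?thesis by (simp add: algebra_simps)
qed

lemma height_interior:
  assumes "z \<in> interior pentagon" "k < 5"
  shows "- cos (pi / 5) < height (2 * pi * real k / 5) z"
proof -
  let ?a = "\<i> * cis (2 * pi * real k / 5)"
  have "pentagon \<subseteq> {z. - cos (pi / 5) \<le> ?a \<bullet> z}"
    unfolding pentagon_def using height_vertex_ge[OF _ assms(2)]
    by (intro hull_minimal convex_halfspace_ge) (auto simp: height_inner)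
  then have "z \<in> interior {z. - cos (pi / 5) \<le> ?a \<bullet> z}" using assms(1) interior_mono by blast
  moreover have "?a \<noteq> 0" by simp
  ultimately show ?thesis using interior_halfspace_ge[of ?a] by (simp add: height_inner)
qed

text \<open>The midpoint of a passage is interior, hence strictly inside the line of every side. So
  the flow moves away from the line of a side where it enters and towards it where it
  leaves.\<close>

lemma passage_transversal:
  assumes "z = z0 + complex_of_real t * cis \<theta>" "0 < t" "open_segment z0 z \<subseteq> interior pentagon"
  shows "z0 \<in> pentagon_side l \<Longrightarrow> 0 < sin (\<theta> - 2 * pi * real (side_index l) / 5)"
    and "z \<in> pentagon_side l \<Longrightarrow> sin (\<theta> - 2 * pi * real (side_index l) / 5) < 0"
proof -
  let ?\<alpha> = "2 * pi * real (side_index l) / 5"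
  have "z0 \<noteq> z" using assms(1,2) by simp
  then have "midpoint z0 z \<in> interior pentagon" using assms(3) by auto
  then have mid: "- cos (pi / 5) < height ?\<alpha> (midpoint z0 z)"
    using height_interior side_index_less by blast
  have z: "height ?\<alpha> z = height ?\<alpha> z0 + t * sin (\<theta> - ?\<alpha>)"
    by (simp add: assms(1) height_add height_of_real height_cis)
  have m: "height ?\<alpha> (midpoint z0 z) = (height ?\<alpha> z0 + height ?\<alpha> z) / 2"
    by (simp add: midpoint_def height_scaleR height_add)
  have gap: "t * sin (\<theta> - ?\<alpha>) = 2 * (height ?\<alpha> (midpoint z0 z) - height ?\<alpha> z0)"
    "t * sin (\<theta> - ?\<alpha>) = 2 * (height ?\<alpha> z - height ?\<alpha> (midpoint z0 z))"
    using z m by simp_all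
  show "0 < sin (\<theta> - ?\<alpha>)" if "z0 \<in> pentagon_side l"
  proof -
    have "0 < t * sin (\<theta> - ?\<alpha>)" using height_side[OF that] mid unfolding gap(1) by simp
    then show ?thesis using assms(2) by (simp add: zero_less_mult_iff)
  qed
  show "sin (\<theta> - ?\<alpha>) < 0" if "z \<in> pentagon_side l"
  proof -
    have "t * sin (\<theta> - ?\<alpha>) < 0" using height_side[OF that] mid unfolding gap(2) by simp
    then show ?thesis using assms(2) by (simp add: mult_less_0_iff)
  qed
qed

text \<open>The sign tells entry sides of Q (1, 3, 5) from exit sides (2, 4). At \<theta> = 0 side 5
  is parallel to the flow and gives 0, hence the weak inequality.\<close>

lemma sin_side_direction:
  assumes "0 \<le> \<theta>" "\<theta> < pi / 5"
  shows "0 \<le> sin (\<theta> - 2 * pi * real (side_index l) / 5) \<longleftrightarrow> l \<in> {L1, L3, L5}"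
proof -
  have pos: "0 < sin (pi / 5 - \<theta>)" "0 < sin (4 * pi / 5 - \<theta>)" "0 < sin (\<theta> + 2 * pi / 5)"
    "0 < sin (2 * pi / 5 - \<theta>)"
    by (rule sin_gt_zero; use assms in linarith)+
  show ?thesis
  proof (cases l)
    case L1
    have "sin (\<theta> - 2 * pi * real 3 / 5) = sin (pi / 5 - \<theta>)"
      using sin_minus_pi[of "\<theta> - pi / 5"] sin_minus[of "\<theta> - pi / 5"] by (simp add: algebra_simps)
    then show ?thesis unfolding L1 side_index.simps using pos(1) by simp
  next
    case L2
    have "sin (\<theta> - 2 * pi * real 2 / 5) = - sin (4 * pi / 5 - \<theta>)"
      using sin_minus[of "4 * pi / 5 - \<theta>"] by (simp add: algebra_simps)
    then show ?thesis unfolding L2 side_index.simps using pos(2) by simp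
  next
    case L3
    have "sin (\<theta> - 2 * pi * real 4 / 5) = sin (\<theta> + 2 * pi / 5)"
      using sin_periodic[of "\<theta> - 2 * pi * 4 / 5"] by (simp add: algebra_simps)
    then show ?thesis unfolding L3 side_index.simps using pos(3) by simp
  next
    case L4
    have "sin (\<theta> - 2 * pi * real 1 / 5) = - sin (2 * pi / 5 - \<theta>)"
      using sin_minus[of "2 * pi / 5 - \<theta>"] by (simp add: algebra_simps)
    then show ?thesis unfolding L4 side_index.simps using pos(4) by simp
  next
    case L5
    have "0 \<le> sin \<theta>" by (rule sin_ge_zero) (use assms in auto)
    then show ?thesis using L5 by simp
  qed
qed

text \<open>
  Upper and lower end of a side of $Q$ with respect to the height across a flow of direction in
  $[0,\pi/5)$; on $-Q$ the half-turn exchanges them.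
\<close>

definition side_top :: "label \<Rightarrow> complex" where
  "side_top l = pentagon_vertex (if l \<in> {L2, L4} then Suc (side_index l) else side_index l)"

definition side_bottom :: "label \<Rightarrow> complex" where
  "side_bottom l = pentagon_vertex (if l \<in> {L2, L4} then side_index l else Suc (side_index l))"

definition top_height :: "real \<Rightarrow> bool \<Rightarrow> label \<Rightarrow> real" where
  "top_height \<theta> b l = (if b then height \<theta> (side_top l) else - height \<theta> (side_bottom l))"

text \<open>The coordinate of a crossing. It refers to the copy of the side on the polygon at hand,
  so that gluing preserves it.\<close>

definition depth :: "real \<Rightarrow> bool \<Rightarrow> label \<Rightarrow> complex \<Rightarrow> real" where
  "depth \<theta> b l z = top_height \<theta> b l - height \<theta> z"

lemma pentagon_side_top_bottom: "pentagon_side l = open_segment (side_top l) (side_bottom l)"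
  unfolding pentagon_side_eq side_top_def side_bottom_def
  by (cases "l \<in> {L2, L4}") (simp_all only: if_True if_False open_segment_commute)

lemma side_top_neq_bottom: "side_top l \<noteq> side_bottom l"
proof -
  have "pentagon_vertex (Suc k) \<noteq> pentagon_vertex k" for k
    unfolding pentagon_vertex_Suc using sin_pi_5_pos by simp
  then show ?thesis unfolding side_top_def side_bottom_def by (auto dest: sym)
qed

lemma uminus_open_segment: "uminus ` open_segment a b = open_segment (- a) (- b)" for a b :: complex
  using open_segment_linear_image[of uminus a b] by (simp add: linear_uminus)

lemma polygon_side_segment:
  "polygon_side b l =
    (if b then open_segment (side_top l) (side_bottom l) else open_segment (- side_bottom l) (- side_top l))"
  unfolding polygon_side_def pentagon_side_top_bottom uminus_open_segment
  by (simp add: open_segment_commute)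

text \<open>Equal segments determine their end points only as an unordered pair; the equal direction
  vectors exclude the exchange.\<close>

lemma translate_open_segment_same_direction:
  fixes a b c :: complex
  assumes "(+) c ` open_segment a b = open_segment a' b'" "b' - a' = b - a" "a \<noteq> b"
  shows "a' = c + a"
proof -
  have "open_segment (c + a) (c + b) = open_segment a' b'"
    using assms(1) open_segment_translation[of c a b] by simp
  then have "{c + a, c + b} = {a', b'}"
    using assms(3) unfolding open_segment_eq by auto
  then show ?thesis
  proof (rule contrapos_pp)
    assume "a' \<noteq> c + a"
    show "{c + a, c + b} \<noteq> {a', b'}"
    proof
      assume "{c + a, c + b} = {a', b'}"
      then have "a' = c + b" "b' = c + a" using \<open>a' \<noteq> c + a\<close> by (auto simp: doubleton_eq_iff)
      then have "2 * (b - a) = 0" using assms(2) by (simp add: algebra_simps)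
      then show False using assms(3) by simp
    qed
  qed
qed

lemma depth_glued:
  assumes "glued b l z z'"
  shows "depth \<theta> (\<not> b) l z' = depth \<theta> b l z"
proof -
  obtain c where c: "(+) c ` polygon_side b l = polygon_side (\<not> b) l" "z' = c + z"
    using assms unfolding glued_def by blast
  have "(if b then - side_bottom l else side_top l) = c + (if b then side_top l else - side_bottom l)"
    by (rule translate_open_segment_same_direction[of c _ "if b then side_bottom l else - side_top l"
          _ "if b then - side_top l else side_bottom l"])
      (use c(1) side_top_neq_bottom[of l] in \<open>auto simp: polygon_side_segment\<close>)
  then have "height \<theta> (if b then - side_bottom l else side_top l) =
      height \<theta> (c + (if b then side_top l else - side_bottom l))" by simp
  then show ?thesis
    unfolding depth_def top_height_def c(2) by (auto simp: height_add height_minus)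
qed

lemma depth_bounds:
  assumes "z \<in> polygon_side b l" "height \<theta> (side_bottom l) < height \<theta> (side_top l)"
  shows "0 < depth \<theta> b l z" "depth \<theta> b l z < height \<theta> (side_top l) - height \<theta> (side_bottom l)"
proof -
  define p q where "p = (if b then side_top l else - side_bottom l)"
    and "q = (if b then side_bottom l else - side_top l)"
  have "z \<in> open_segment p q"
    using assms(1) unfolding polygon_side_segment p_def q_def by (cases b) simp_all
  then obtain s where s: "0 < s" "s < 1" "z = (1 - s) *\<^sub>R p + s *\<^sub>R q"
    unfolding in_segment by blast
  have "depth \<theta> b l z = s * (height \<theta> (side_top l) - height \<theta> (side_bottom l))"
    unfolding depth_def top_height_def s(3) height_add height_scaleR p_def q_def
    by (cases b) (simp_all add: height_minus algebra_simps)
  then show "0 < depth \<theta> b l z" "depth \<theta> b l z < height \<theta> (side_top l) - height \<theta> (side_bottom l)"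
    using s(1,2) assms(2) by simp_all
qed

section \<open>The sides and passages seen from a fixed direction\<close>

context
  fixes \<theta> u v :: real
  assumes \<theta>: "0 \<le> \<theta>" "\<theta> < pi / 5"
  defines "u \<equiv> 2 * sin (pi / 5) * sin (pi / 5 - \<theta>)"
    and "v \<equiv> 2 * sin (pi / 5) * sin \<theta>"
begin

lemma upper_width_pos: "0 < u" and bottom_width_nonneg: "0 \<le> v"
proof -
  have "0 < sin (pi / 5 - \<theta>)" by (rule sin_gt_zero) (use \<theta> in auto)
  moreover have "0 \<le> sin \<theta>" by (rule sin_ge_zero) (use \<theta> in auto)
  ultimately show "0 < u" "0 \<le> v" using sin_pi_5_pos by (simp_all add: u_def v_def)
qed

text \<open>From the highest down, the vertices come in the order 3, 4, 2, 0, 1. The factor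
  \<open>2 * sin (pi / 5)\<close> in \<open>u\<close> and \<open>v\<close> is the side length, and
  \<open>golden\<close> enters by sin (x + pi / 5) + sin (x - pi / 5) = 2 cos (pi / 5) sin
  x.\<close>

lemma vertex_heights:
  "height \<theta> (pentagon_vertex 4) = height \<theta> (pentagon_vertex 3) - u"
  "height \<theta> (pentagon_vertex 2) = height \<theta> (pentagon_vertex 4) - golden * v"
  "height \<theta> (pentagon_vertex 0) = height \<theta> (pentagon_vertex 2) - golden * u"
  "height \<theta> (pentagon_vertex 1) = height \<theta> (pentagon_vertex 0) - v"
  "height \<theta> (pentagon_vertex 5) = height \<theta> (pentagon_vertex 0)"
proof -
  note step = height_vertex_Suc[of \<theta>]
  have s3: "sin (6 * pi / 5 - \<theta>) = - sin (pi / 5 - \<theta>)" 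
    using sin_periodic_pi[of "pi / 5 - \<theta>"] by (simp add: algebra_simps)
  show "height \<theta> (pentagon_vertex 4) = height \<theta> (pentagon_vertex 3) - u"
    using step[of 3] s3 by (simp add: u_def eval_nat_numeral)
  have sum: "sin (x + pi / 5) + sin (x - pi / 5) = golden * sin x" for x
    by (simp add: sin_add sin_diff golden_def)
  have s2: "sin (4 * pi / 5 - \<theta>) = golden * sin \<theta> + sin (pi / 5 - \<theta>)"
    using sum[of \<theta>] sin_pi_minus[of "\<theta> + pi / 5"] sin_minus[of "\<theta> - pi / 5"]
    by (simp add: algebra_simps)
  show "height \<theta> (pentagon_vertex 2) = height \<theta> (pentagon_vertex 4) - golden * v"
    using step[of 3] step[of 2] s2 s3 by (simp add: u_def v_def eval_nat_numeral algebra_simps)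
  have s1: "sin (2 * pi / 5 - \<theta>) = golden * sin (pi / 5 - \<theta>) + sin \<theta>"
    using sum[of "pi / 5 - \<theta>"] by (simp add: algebra_simps)
  show "height \<theta> (pentagon_vertex 0) = height \<theta> (pentagon_vertex 2) - golden * u"
    using step[of 1] step[of 0] s1 by (simp add: u_def v_def eval_nat_numeral algebra_simps)
  show "height \<theta> (pentagon_vertex 1) = height \<theta> (pentagon_vertex 0) - v"
    using step[of 0] by (simp add: v_def)
  have "height \<theta> (pentagon_vertex 5) = height \<theta> (pentagon_vertex 0)"
  proof -
    have "2 * pi * real 5 / 5 - 7 * pi / 10 - \<theta> = 2 * pi * real 0 / 5 - 7 * pi / 10 - \<theta> + 2 * pi" by simp
    then show ?thesis unfolding height_vertex by (simp only: sin_periodic)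
  qed
  then show "height \<theta> (pentagon_vertex 5) = height \<theta> (pentagon_vertex 0)" .
qed

lemma height_top_bottom:
  "height \<theta> (side_top l) - height \<theta> (side_bottom l) = width u v (golden * u) (golden * v) l"
  using vertex_heights by (cases l) (simp_all add: side_top_def side_bottom_def eval_nat_numeral)

lemma side_heights:
  "height \<theta> (side_top L3) = height \<theta> (side_top L1) - u"
  "height \<theta> (side_top L5) = height \<theta> (side_top L1) - u - golden * v - golden * u"
  "height \<theta> (side_top L2) = height \<theta> (side_top L1)"
  "height \<theta> (side_top L4) = height \<theta> (side_top L1) - u - golden * v"
  using vertex_heights by (simp_all add: side_top_def eval_nat_numeral)

lemma side_heights_bottom:
  "height \<theta> (side_bottom l) = height \<theta> (side_top l) - width u v (golden * u) (golden * v) l"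
  using height_top_bottom[of l] by simp

lemma side_direction_sign:
  assumes "sin (\<theta> - 2 * pi * real (side_index l) / 5) \<noteq> 0"
  shows "0 < width u v (golden * u) (golden * v) l"
proof -
  let ?s = "sin (\<theta> - 2 * pi * real (side_index l) / 5)"
  have "sin (2 * pi * real (side_index l) / 5 - \<theta>) = - ?s" by (metis minus_diff_eq sin_minus)
  then have "height \<theta> (side_top l) - height \<theta> (side_bottom l) =
      2 * sin (pi / 5) * (if l \<in> {L1, L3, L5} then ?s else - ?s)"
    by (cases l) (simp_all add: side_top_def side_bottom_def height_vertex_Suc del: side_index.simps)
  moreover have "0 < (if l \<in> {L1, L3, L5} then ?s else - ?s)"
    using assms sin_side_direction[OF \<theta>, of l] by auto
  ultimately show ?thesis using height_top_bottom[of l] sin_pi_5_pos by simp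
qed

lemma passage_labels:
  assumes "z = z0 + complex_of_real t * cis \<theta>" "0 < t" "open_segment z0 z \<subseteq> interior (polygon b)"
  shows "z0 \<in> polygon_side b l \<Longrightarrow>
      (l \<in> {L1, L3, L5} \<longleftrightarrow> b) \<and> 0 < width u v (golden * u) (golden * v) l"
    and "z \<in> polygon_side b l \<Longrightarrow>
      (l \<in> {L1, L3, L5} \<longleftrightarrow> \<not> b) \<and> 0 < width u v (golden * u) (golden * v) l"
proof -
  let ?s = "sin (\<theta> - 2 * pi * real (side_index l) / 5)"
  \<comment> \<open>The half-turn carries a passage through -Q to one through Q in the same
    direction, with entry and exit exchanged.\<close>
  have neg: "- z0 = - z + complex_of_real t * cis \<theta>" using assms(1) by simp
  have interior: "open_segment (- z) (- z0) \<subseteq> interior pentagon" if "\<not> b"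
  proof -
    have "open_segment (- z) (- z0) = uminus ` open_segment z0 z"
      unfolding uminus_open_segment by (rule open_segment_commute)
    also have "\<dots> \<subseteq> uminus ` interior (uminus ` pentagon)"
      using assms(3) that by (intro image_mono) (simp add: polygon_def)
    finally show ?thesis by (simp add: interior_negations image_image)
  qed
  have sign: "0 < ?s \<Longrightarrow> l \<in> {L1, L3, L5}" "?s < 0 \<Longrightarrow> l \<notin> {L1, L3, L5}"
    using sin_side_direction[OF \<theta>, of l] by auto
  have side: "- x \<in> pentagon_side l" if "x \<in> polygon_side b l" "\<not> b" for x
    using that unfolding polygon_side_def by auto
  show "(l \<in> {L1, L3, L5} \<longleftrightarrow> b) \<and> 0 < width u v (golden * u) (golden * v) l"
    if "z0 \<in> polygon_side b l"
  proof (cases b)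
    case True
    then have "0 < ?s"
      using passage_transversal(1)[OF assms(1,2)] assms(3) that
      by (simp add: polygon_def polygon_side_def)
    then show ?thesis using True sign(1) side_direction_sign[of l] by simp
  next
    case False
    then have "?s < 0"
      using passage_transversal(2)[OF neg assms(2) interior] side[OF that] by simp
    then show ?thesis using False sign(2) side_direction_sign[of l] by simp
  qed
  show "(l \<in> {L1, L3, L5} \<longleftrightarrow> \<not> b) \<and> 0 < width u v (golden * u) (golden * v) l"
    if "z \<in> polygon_side b l"
  proof (cases b)
    case True
    then have "?s < 0"
      using passage_transversal(2)[OF assms(1,2)] assms(3) that
      by (simp add: polygon_def polygon_side_def)
    then show ?thesis using True sign(2) side_direction_sign[of l] by simp
  next
    case False
    then have "0 < ?s"
      using passage_transversal(1)[OF neg assms(2) interior] side[OF that] by simp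
    then show ?thesis using False sign(1) side_direction_sign[of l] by simp
  qed
qed

text \<open>The height is constant along a passage, so the depth changes by the difference of the
  upper ends. Pairs such as 1 and 4, whose open height ranges are disjoint, are excluded by the
  bounds on the depths.\<close>

lemma passage_step:
  assumes "z = z0 + complex_of_real t * cis \<theta>" "0 < t" "open_segment z0 z \<subseteq> interior (polygon b)"
    and "z0 \<in> polygon_side b l" "z \<in> polygon_side b l'"
  shows "step u v (golden * u) (golden * v) (l, depth \<theta> b l z0) (l', depth \<theta> b l' z)"
proof -
  let ?w = "width u v (golden * u) (golden * v)"
  have l: "l \<in> {L1, L3, L5} \<longleftrightarrow> b" "l' \<in> {L1, L3, L5} \<longleftrightarrow> \<not> b" "0 < ?w l" "0 < ?w l'"
    using passage_labels[OF assms(1-3)] assms(4,5) by blast+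
  have "0 < depth \<theta> b l z0" "depth \<theta> b l z0 < ?w l"
    using depth_bounds[OF assms(4), of \<theta>] height_top_bottom[of l] l(3) by simp_all
  moreover have "0 < depth \<theta> b l' z" "depth \<theta> b l' z < ?w l'"
    using depth_bounds[OF assms(5), of \<theta>] height_top_bottom[of l'] l(4) by simp_all
  moreover have "height \<theta> z = height \<theta> z0"
    by (simp add: assms(1) height_add height_of_real height_cis)
  then have "depth \<theta> b l' z = depth \<theta> b l z0 + (top_height \<theta> b l' - top_height \<theta> b l)"
    by (simp add: depth_def)
  moreover have "0 < golden * u" "0 \<le> golden * v" using golden_gt_1 upper_width_pos bottom_width_nonneg by auto
  ultimately show ?thesis
    using l(1,2) upper_width_pos bottom_width_nonneg
    by (cases l; cases l'; cases b) (auto simp: top_height_def side_heights_bottom side_heights)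
qed

lemma trajectory_step:
  assumes "trajectory \<theta> T"
  defines "st \<equiv> \<lambda>n. (exit_label (T n), depth \<theta> (in_Q (T n)) (exit_label (T n)) (exit_point (T n)))"
  shows "step u v (golden * u) (golden * v) (st n) (st (n + 1))"
proof -
  have T: "(\<exists>t>0. exit_point (T n) = entry_point (T n) + complex_of_real t * cis \<theta>)"
    "open_segment (entry_point (T n)) (exit_point (T n)) \<subseteq> interior (polygon (in_Q (T n)))"
    "in_Q (T (n + 1)) = (\<not> in_Q (T n))"
    "glued (in_Q (T n)) (exit_label (T n)) (exit_point (T n)) (entry_point (T (n + 1)))" for n
    using assms(1) unfolding trajectory_def by blast+
  obtain t where t: "0 < t" "exit_point (T (n + 1)) = entry_point (T (n + 1)) + complex_of_real t * cis \<theta>"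
    using T(1) by blast
  have entry: "entry_point (T (n + 1)) \<in> polygon_side (in_Q (T (n + 1))) (exit_label (T n))"
    using T(4)[of n] T(3)[of n] unfolding glued_def by force
  have exit: "exit_point (T (n + 1)) \<in> polygon_side (in_Q (T (n + 1))) (exit_label (T (n + 1)))"
    using T(4)[of "n + 1"] unfolding glued_def by blast
  have "depth \<theta> (in_Q (T (n + 1))) (exit_label (T n)) (entry_point (T (n + 1))) = snd (st n)"
    using depth_glued[OF T(4)[of n]] T(3)[of n] by (simp add: st_def)
  then show ?thesis
    using passage_step[OF t(2,1) T(2) entry exit] by (simp add: st_def)
qed

end

section \<open>Periodic trajectories\<close>

lemma step_displacement:
  assumes "step u v U V s s1" "step u v U V t t1" "fst s = fst t" "fst s1 = fst t1"
  shows "snd s1 - snd s = snd t1 - snd t"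
  using assms(1)
proof cases
qed (use assms(2-) in \<open>cases, auto\<close>)+

lemma run_of_orbit:
  assumes "\<And>n. S (st n) (st (n + 1))"
  shows "run S (st m) (map (\<lambda>i. (fst (st (m + int i)), fst (st (m + int i + 1)))) [0..<k]) (st (m + int k))"
proof (induction k)
  case (Suc k)
  have "m + int (Suc k) = m + int k + 1" by simp
  then have "run S (st (m + int k)) [(fst (st (m + int k)), fst (st (m + int k + 1)))] (st (m + int (Suc k)))"
    using assms[of "m + int k"] unfolding run.simps by metis
  then have "run S (st m) (map (\<lambda>i. (fst (st (m + int i)), fst (st (m + int i + 1)))) [0..<k] @
      [(fst (st (m + int k)), fst (st (m + int k + 1)))]) (st (m + int (Suc k)))"
    using Suc unfolding run_append by blast
  then show ?case by simp
qed simp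

lemma has_period_multiple:
  assumes "has_period f k"
  shows "f (n + int j * int k) = f n"
proof (induction j)
  case (Suc j)
  have "f (n + int j * int k + int k) = f (n + int j * int k)"
    using assms unfolding has_period_def by blast
  then show ?case using Suc by (simp add: algebra_simps)
qed simp

text \<open>The drift \<open>c\<close> over K steps does not depend on n, because equal pairs of
  labels mean equal translations. After N times K steps the crossing is back, so N drifts add up to
  zero.\<close>

lemma orbit_period:
  assumes step: "\<And>n. step u v U V (st n) (st (n + 1))"
    and "has_period st N" and K: "has_period (\<lambda>n. fst (st n)) K"
  shows "st (n + int K) = st n"
proof -
  define c where "c n = snd (st (n + int K)) - snd (st n)" for n
  have fst_eq: "fst (st (n + int K)) = fst (st n)" for n
    using K unfolding has_period_def by blast
  have "c (n + 1) = c n" for n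
    using step_displacement[OF step[of "n + int K"] step[of n]] fst_eq[of n] fst_eq[of "n + 1"]
    by (simp add: c_def algebra_simps)
  then have c_const: "c (n + int i) = c n" for n i
    by (induction i) (simp_all add: algebra_simps, metis add.assoc add.commute)
  have "snd (st (n + int j * int K)) = snd (st n) + real j * c n" for n j
  proof (induction j)
    case (Suc j)
    have "c (n + int j * int K) = c n" using c_const[of n "j * K"] by simp
    then show ?case using Suc by (simp add: c_def algebra_simps)
  qed simp
  from this[of n N] have "real N * c n = 0"
    using has_period_multiple[OF assms(2), of n K] by (simp add: mult.commute)
  then have "c n = 0" using assms(2) unfolding has_period_def by simp
  then show ?thesis using fst_eq[of n] by (simp add: c_def prod_eq_iff)
qed

lemma has_period_mod:
  assumes "has_period f K" shows "f n = f (m + (n - m) mod int K)"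
proof -
  let ?q = "(n - m) div int K"
  have n: "n = m + (n - m) mod int K + ?q * int K" by simp
  show ?thesis
  proof (cases "0 \<le> ?q")
    case True
    then show ?thesis using has_period_multiple[OF assms, of "m + (n - m) mod int K" "nat ?q"] n by simp
  next
    case False
    then have "m + (n - m) mod int K = n + int (nat (- ?q)) * int K" using n by (simp add: algebra_simps)
    then show ?thesis using has_period_multiple[OF assms, of n "nat (- ?q)"] by simp
  qed
qed

lemma decorate_period_word:
  assumes "has_period e (length w)" "w = map (\<lambda>i. e (m + int i)) [0..<length w]"
  shows "decorate w = map (\<lambda>i. (e (m + int i), e (m + int i + 1))) [0..<length w]"
proof (rule nth_equalityI)
  fix i assume "i < length (decorate w)"
  then have i: "i < length w" by simp
  have w: "w ! j = e (m + int j)" if "j < length w" for j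
    using that by (subst assms(2)) simp
  have "e (m + int i + 1) = e (m + int (Suc i mod length w))"
    using has_period_mod[OF assms(1), of "m + int i + 1" m] by (simp add: zmod_int algebra_simps)
  moreover have "Suc i mod length w < length w" using i by (intro mod_less_divisor) linarith
  ultimately show "decorate w ! i = map (\<lambda>i. (e (m + int i), e (m + int i + 1))) [0..<length w] ! i"
    using i w by (simp add: decorate_def nth_rotate1)
qed simp

text \<open>A rotation fixing the decorated word fixes its bases and extends by periodicity to a
  period of \<open>e\<close> shorter than the shortest one.\<close>

lemma primitive_period_word:
  assumes "period_word e w"
  shows "primitive (decorate w)"
  unfolding primitive_def
proof (intro allI impI notI)
  fix k assume k: "0 < k \<and> k < length (decorate w)" and rot: "rotate k (decorate w) = decorate w"
  from assms obtain m where w: "has_period e (length w)" "\<And>k. has_period e k \<Longrightarrow> length w \<le> k"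
    "w = map (\<lambda>i. e (m + int i)) [0..<length w]" unfolding period_word_def by blast
  have "rotate k w = w" using rot decorate_rotate by (metis map_fst_decorate)
  have nth: "w ! j = e (m + int j)" if "j < length w" for j
    using that by (subst w(3)) simp
  have pos: "0 < length w" using w(1) unfolding has_period_def by blast
  have "e (n + int k) = e n" for n
  proof -
    define j where "j = nat ((n - m) mod int (length w))"
    have j: "j < length w" "int j = (n - m) mod int (length w)"
      using pos by (simp_all add: j_def nat_less_iff)
    have "e (n + int k) = e (m + (int k + int j) mod int (length w))"
      using has_period_mod[OF w(1), of "n + int k" m] j(2) by (simp add: mod_simps algebra_simps)
    also have "\<dots> = w ! ((k + j) mod length w)"
      using nth[of "(k + j) mod length w"] pos by (simp add: zmod_int)
    also have "\<dots> = rotate k w ! j" using nth_rotate[OF j(1)] by simp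
    also have "\<dots> = e n" using \<open>rotate k w = w\<close> nth[OF j(1)] j(2) has_period_mod[OF w(1), of n m] by simp
    finally show ?thesis .
  qed
  then have "has_period e k" using k unfolding has_period_def by blast
  then show False using w(2) k by fastforce
qed

lemma periodic_cutting_sequence_substitution_word:
  assumes "0 \<le> \<theta>" "\<theta> < pi / 5" "periodic_trajectory \<theta> T" "period_word (cutting_sequence T) w"
  shows "\<exists>x\<in>substitution_words. cyclic_shift (decorate w) x"
proof -
  define u v where "u = 2 * sin (pi / 5) * sin (pi / 5 - \<theta>)" and "v = 2 * sin (pi / 5) * sin \<theta>"
  let ?S = "step u v (golden * u) (golden * v)"
  define st where "st n = (exit_label (T n), depth \<theta> (in_Q (T n)) (exit_label (T n)) (exit_point (T n)))" for n
  have traj: "trajectory \<theta> T" and "\<exists>N. has_period T N"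
    using assms(3) unfolding periodic_trajectory_def by blast+
  then obtain N where "has_period T N" by blast
  then have N: "has_period st N" unfolding has_period_def st_def by simp
  have step: "?S (st n) (st (n + 1))" for n
    using trajectory_step[OF assms(1,2) traj] unfolding st_def u_def v_def .
  have e: "cutting_sequence T = (\<lambda>n. fst (st n))" by (simp add: cutting_sequence_def st_def fun_eq_iff)
  obtain m where w: "has_period (\<lambda>n. fst (st n)) (length w)"
    "w = map (\<lambda>i. fst (st (m + int i))) [0..<length w]"
    using assms(4) unfolding period_word_def e by blast
  \<comment> \<open>A symbol pairs the side just crossed with the next one, so one period of the
    orbit reads \<open>decorate w\<close>; the run closes by \<open>orbit_period\<close>.\<close>
  have "run ?S (st m) (decorate w) (st m)"
    using run_of_orbit[of ?S st m "length w", OF step] orbit_period[OF step N w(1), of m]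
      decorate_period_word[OF w] by simp
  moreover have "decorate w \<noteq> []"
    using w(1) unfolding has_period_def by (metis length_0_conv length_decorate less_irrefl)
  moreover have "0 < u" "0 \<le> v" using upper_width_pos[OF assms(1,2)] bottom_width_nonneg[OF assms(1,2)] by (simp_all add: u_def v_def)
  ultimately show ?thesis
    using closed_run_substitution_word[OF golden_gt_1 golden_square] primitive_period_word[OF assms(4)] by blast
qed

theorem corollary3p19:
  fixes \<theta> :: real and T :: "int \<Rightarrow> passage" and w :: "label list"
  assumes "0 \<le> \<theta>" and "\<theta> < pi / 5"
    and "periodic_trajectory \<theta> T"
    and "period_word (cutting_sequence T) w"
  shows "cyclic_shift (decorate w) (rev (map prod.swap (decorate w))) \<and>
         cyclic_shift (digits (decorate w)) (rev (digits (decorate w))) \<and>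
         (\<exists>u \<in> substitution_words. cyclic_shift (decorate w) u) \<and>
         (\<forall>u \<in> substitution_words. cyclic_shift (decorate w) u \<longrightarrow>
            rev (tl (map fst u)) = tl (map fst u))"
  using periodic_cutting_sequence_substitution_word[OF assms] palindromic_properties by blast

end
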